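(* Let $T=(X,\hat X,(\phi_\lambda)_{\lambda\in\hat X})$ be an abstract integral transform and let $(P_t)_{t\ge0}$ be a semigroup of Markov kernels on $X$ related with $T$, with negative definite function $\psi$ and generator $L$. Then the following are equivalent for any càdlàg process $(X_t)_{t\ge0}$ on $X$ (martingales being understood with respect to the canonical filtration of $(X_t)_{t\ge 0}$): (1) $(X_t)_{t\ge0}$ is a Markov process associated with the semigroup $(P_t)_{t\ge0}$. (2) For each $\lambda\in\hat X$, the process $\bigl(\frac{1}{P_t(e,\cdot)^\wedge(\lambda)}\phi_\lambda(X_t)\bigr)_{t\ge0}$ is a martingale. (3) For each $\lambda\in\hat X$, the process $\bigl(\phi_\lambda(X_t)+\psi(\lambda)\int_0^t\phi_\lambda(X_s)\,ds\bigr)_{t\ge0}$ is a martingale. (4) For each $\lambda\in\hat X$, $\Pi_X^{L,\phi_\lambda}$ is a martingale. (5) For each $f\in D_b(L)$, $\Pi_X^{L,f}$ is a martingale.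
   Context: $C_b(X)$, $C_0(X)$ denote continuous complex functions on a locally compact Hausdorff space $X$ that are bounded, respectively vanish at infinity; $M_b(X)$, $M^+(X)$, $M^1(X)$ denote regular Borel measures on $X$ that are bounded, respectively positive (Radon), respectively probability measures. An abstract integral transform is a triple $T=(X,\hat X,(\phi_\lambda)_{\lambda\in\hat X})$ where $X$ is a second countable locally compact space, $\hat X$ a locally compact space, $\phi_\lambda\in C_b(X)$ with $|\phi_\lambda(x)|\le 1$ for all $x,\lambda$, such that: (1) $\lambda\mapsto\phi_\lambda$ is continuous with respect to the compact-uniform topology on $C_b(X)$; (2) there are $e\in X$ with $\phi_\lambda(e)=1$ for all $\lambda\in\hat X$ and $\hat e\in\hat X$ with $\phi_{\hat e}(x)=1$ for all $x\in X$; (3) there is $\pi\in M^+(\hat X)$ such that for all $f\in L^1(\hat X,\pi)$ the function $\check f(x):=\int_{\hat X}f(\lambda)\phi_\lambda(x)\,d\pi(\lambda)$ lies in $C_0(X)$, and $\{\check f: f\in L^1(\hat X,\pi)\}$ is $\|\cdot\|_\infty$-dense in $C_0(X)$. (Spaces are Hausdorff.) For $\mu\in M_b(X)$, $\hat\mu(\lambda)=\mu^\wedge(\lambda):=\int_X\phi_\lambda\,d\mu$. A Markov kernel $P$ on $X$ is related with $T$ if $P(x,\cdot)^\wedge(\lambda)=P(e,\cdot)^\wedge(\lambda)\phi_\lambda(x)$ for all $x\in X,\lambda\in\hat X$. A (continuous) semigroup $(P_t)_{t\ge0}$ of Markov kernels related with $T$ satisfies $P_s\circ P_t=P_{s+t}$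 (with $P\circ Q(x,A)=\int_X Q(z,A)P(x,dz)$), $P_0(x,\cdot)=\delta_x$, and $t\mapsto P_t(e,\cdot)\in M^1(X)$ is weakly continuous. There is then a unique continuous function $\psi:\hat X\to\mathbb C$ with $P_t(e,\cdot)^\wedge(\lambda)=e^{-t\psi(\lambda)}$ for all $t\ge 0$, namely $\psi(\lambda)=\lim_{t\downarrow0}\frac1t(1-P_t(e,\cdot)^\wedge(\lambda))$; it is called the negative definite function associated with $(P_t)_{t\ge 0}$. Put $P_tf(x)=\int_X f(y)\,P_t(x,dy)$. The generator is $Lf:=\lim_{t\to0}\frac1t(P_tf-f)$, considered on $D(L):=\{f\in C(X):\frac1t(P_tf-f)\text{ converges uniformly on }X\text{ for }t\to0\}$, and $D_b(L):=D(L)\cap C_b(X)$. One has $\phi_\lambda\in D_b(L)$ with $L\phi_\lambda=-\psi(\lambda)\phi_\lambda$. For a càdlàg process $(X_t)_{t\ge0}$ on $X$ and $f\in D(L)$ put $\Pi_X^{L,f}:=\bigl(f(X_t)-f(X_0)-\int_0^tL(f)(X_s)\,ds\bigr)_{t\ge0}$. A process is a Markov process associated with $(P_t)_{t\ge 0}$ if $P(X_t\in B\mid\sigma(X_u:u\le s))=P_{t-s}(X_s,B)$ a.s. for all $0\le s\le t$ and Borel sets $B\subset X$ (arbitrary initial distribution). *)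

theory Defs
  imports "HOL-Probability.Probability"
begin

definition Cb :: "('x::topological_space \<Rightarrow> complex) set" where
  "Cb = {f. continuous_on UNIV f \<and> bounded (range f)}"

definition C0 :: "('x::topological_space \<Rightarrow> complex) set" where
  "C0 = {f. continuous_on UNIV f \<and>
            (\<forall>\<epsilon>>0. \<exists>K. compact K \<and> (\<forall>x. x \<notin> K \<longrightarrow> cmod (f x) < \<epsilon>))}"

text \<open>
  Positive Radon measures on a locally compact Hausdorff space, in the convention of the Riesz
  representation theorem: inner regularity is only required on open sets, because the space need
  not be \<open>\<sigma>\<close>-compact.
\<close>

definition radon_measure :: "'l::t2_space measure \<Rightarrow> bool" where
  "radon_measure \<pi> \<longleftrightarrow>
     sets \<pi> = sets borel \<and>
     (\<forall>K. compact K \<longrightarrow> emeasure \<pi> K < \<infinity>) \<and>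
     (\<forall>A\<in>sets borel. emeasure \<pi> A = (INF U\<in>{U. open U \<and> A \<subseteq> U}. emeasure \<pi> U)) \<and>
     (\<forall>U. open U \<longrightarrow> emeasure \<pi> U = (SUP K\<in>{K. compact K \<and> K \<subseteq> U}. emeasure \<pi> K))"

definition inverse_transform ::
    "('l \<Rightarrow> 'x \<Rightarrow> complex) \<Rightarrow> 'l measure \<Rightarrow> ('l \<Rightarrow> complex) \<Rightarrow> 'x \<Rightarrow> complex" where
  "inverse_transform \<phi> \<pi> f x = (\<integral>\<xi>. f \<xi> * \<phi> \<xi> x \<partial>\<pi>)"

text \<open>
  The space \<open>X\<close> and its dual are the types \<open>'x\<close> and \<open>'l\<close>; Hausdorffness and second countability
  are carried by the type classes. Continuity of \<open>\<xi> \<mapsto> \<phi> \<xi>\<close> for the compact-uniform topology is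
  uniform convergence on every compact set.
\<close>

definition abstract_integral_transform ::
    "('l::t2_space \<Rightarrow> 'x::{second_countable_topology, t2_space} \<Rightarrow> complex) \<Rightarrow> bool" where
  "abstract_integral_transform \<phi> \<longleftrightarrow>
     locally_compact_space (euclidean :: 'x topology) \<and>
     locally_compact_space (euclidean :: 'l topology) \<and>
     (\<forall>\<xi>. \<phi> \<xi> \<in> Cb) \<and>
     (\<forall>\<xi> x. cmod (\<phi> \<xi> x) \<le> 1) \<and>
     (\<forall>\<xi>\<^sub>0 K. compact K \<longrightarrow> uniform_limit K \<phi> (\<phi> \<xi>\<^sub>0) (nhds \<xi>\<^sub>0)) \<and>
     (\<exists>e. \<forall>\<xi>. \<phi> \<xi> e = 1) \<and>
     (\<exists>\<xi>\<^sub>0. \<forall>x. \<phi> \<xi>\<^sub>0 x = 1) \<and>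
     (\<exists>\<pi>. radon_measure \<pi> \<and>
        (\<forall>f. integrable \<pi> f \<longrightarrow> inverse_transform \<phi> \<pi> f \<in> C0) \<and>
        (\<forall>g\<in>C0. \<forall>\<epsilon>>0. \<exists>f. integrable \<pi> f \<and>
           (\<forall>x. cmod (inverse_transform \<phi> \<pi> f x - g x) \<le> \<epsilon>)))"

definition transform :: "('l \<Rightarrow> 'x \<Rightarrow> complex) \<Rightarrow> 'x measure \<Rightarrow> 'l \<Rightarrow> complex" where
  "transform \<phi> \<mu> \<xi> = (\<integral>x. \<phi> \<xi> x \<partial>\<mu>)"

definition markov_kernel :: "('x::topological_space \<Rightarrow> 'x measure) \<Rightarrow> bool" where
  "markov_kernel P \<longleftrightarrow> P \<in> borel \<rightarrow>\<^sub>M prob_algebra borel"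

definition related_kernel ::
    "('l \<Rightarrow> 'x \<Rightarrow> complex) \<Rightarrow> 'x \<Rightarrow> ('x \<Rightarrow> 'x measure) \<Rightarrow> bool" where
  "related_kernel \<phi> e P \<longleftrightarrow>
     (\<forall>x \<xi>. transform \<phi> (P x) \<xi> = transform \<phi> (P e) \<xi> * \<phi> \<xi> x)"

text \<open>
  Only times \<open>t \<ge> 0\<close> are meaningful. The measure \<open>P s x \<bind> P t\<close> is the composition
  \<open>A \<mapsto> \<integral> P t z A \<partial>(P s x)\<close>.
\<close>

definition related_semigroup ::
    "('l \<Rightarrow> 'x::topological_space \<Rightarrow> complex) \<Rightarrow> 'x \<Rightarrow> (real \<Rightarrow> 'x \<Rightarrow> 'x measure) \<Rightarrow> bool" where
  "related_semigroup \<phi> e P \<longleftrightarrow>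
     (\<forall>t\<ge>0. markov_kernel (P t) \<and> related_kernel \<phi> e (P t)) \<and>
     (\<forall>s\<ge>0. \<forall>t\<ge>0. \<forall>x. P s x \<bind> P t = P (s + t) x) \<and>
     (\<forall>x. P 0 x = return borel x) \<and>
     (\<forall>f\<in>Cb. continuous_on {0..} (\<lambda>t. \<integral>x. f x \<partial>P t e))"

text \<open>
  The negative definite function \<open>\<psi>\<close> of a related semigroup is the function determined by
  \<open>transform \<phi> (P t e) \<xi> = exp (- t * \<psi> \<xi>)\<close> for all \<open>t \<ge> 0\<close>. It is given here by the
  limit formula \<open>\<psi> \<xi> = lim (1 - transform \<phi> (P t e) \<xi>) / t\<close> as \<open>t\<close> decreases to \<open>0\<close>.
\<close>

definition neg_def_function ::
    "('l \<Rightarrow> 'x \<Rightarrow> complex) \<Rightarrow> 'x \<Rightarrow> (real \<Rightarrow> 'x \<Rightarrow> 'x measure) \<Rightarrow> 'l \<Rightarrow> complex" where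
  "neg_def_function \<phi> e P \<xi> =
     Lim (at_right 0) (\<lambda>t. (1 - transform \<phi> (P t e) \<xi>) / complex_of_real t)"

definition kernel_op :: "('x \<Rightarrow> 'x measure) \<Rightarrow> ('x \<Rightarrow> complex) \<Rightarrow> 'x \<Rightarrow> complex" where
  "kernel_op Q f x = (\<integral>y. f y \<partial>Q x)"

definition diff_quotient ::
    "(real \<Rightarrow> 'x \<Rightarrow> 'x measure) \<Rightarrow> ('x \<Rightarrow> complex) \<Rightarrow> real \<Rightarrow> 'x \<Rightarrow> complex" where
  "diff_quotient P f t x = (kernel_op (P t) f x - f x) / complex_of_real t"

definition generator ::
    "(real \<Rightarrow> 'x \<Rightarrow> 'x measure) \<Rightarrow> ('x \<Rightarrow> complex) \<Rightarrow> 'x \<Rightarrow> complex" where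
  "generator P f x = Lim (at_right 0) (\<lambda>t. diff_quotient P f t x)"

text \<open>
  Functions in the domain may be unbounded, so integrability is made explicit: otherwise
  \<open>kernel_op (P t) f\<close> could be the default value of a divergent integral. For bounded \<open>f\<close> the
  condition is automatic.
\<close>

definition generator_domain ::
    "(real \<Rightarrow> 'x::topological_space \<Rightarrow> 'x measure) \<Rightarrow> ('x \<Rightarrow> complex) set" where
  "generator_domain P = {f. continuous_on UNIV f \<and>
     (\<forall>\<^sub>F t in at_right 0. \<forall>x. integrable (P t x) f) \<and>
     (\<exists>g. uniform_limit UNIV (diff_quotient P f) g (at_right 0))}"

definition bounded_generator_domain ::
    "(real \<Rightarrow> 'x::topological_space \<Rightarrow> 'x measure) \<Rightarrow> ('x \<Rightarrow> complex) set" where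
  "bounded_generator_domain P = generator_domain P \<inter> Cb"

definition cadlag_process ::
    "'w measure \<Rightarrow> (real \<Rightarrow> 'w \<Rightarrow> 'x::topological_space) \<Rightarrow> bool" where
  "cadlag_process M X \<longleftrightarrow>
     (\<forall>t\<ge>0. X t \<in> borel_measurable M) \<and>
     (\<forall>\<omega>\<in>space M.
        (\<forall>t\<ge>0. ((\<lambda>s. X s \<omega>) \<longlongrightarrow> X t \<omega>) (at_right t)) \<and>
        (\<forall>t>0. \<exists>l. ((\<lambda>s. X s \<omega>) \<longlongrightarrow> l) (at_left t)))"

definition canonical_filtration ::
    "'w measure \<Rightarrow> (real \<Rightarrow> 'w \<Rightarrow> 'x::topological_space) \<Rightarrow> real \<Rightarrow> 'w measure" where
  "canonical_filtration M X t =
     sigma (space M) {X u -` B \<inter> space M | u B. 0 \<le> u \<and> u \<le> t \<and> B \<in> sets borel}"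

definition complex_cond_exp ::
    "'w measure \<Rightarrow> 'w measure \<Rightarrow> ('w \<Rightarrow> complex) \<Rightarrow> 'w \<Rightarrow> complex" where
  "complex_cond_exp M F f \<omega> =
     Complex (real_cond_exp M F (\<lambda>\<omega>. Re (f \<omega>)) \<omega>) (real_cond_exp M F (\<lambda>\<omega>. Im (f \<omega>)) \<omega>)"

definition martingale ::
    "'w measure \<Rightarrow> (real \<Rightarrow> 'w measure) \<Rightarrow> (real \<Rightarrow> 'w \<Rightarrow> complex) \<Rightarrow> bool" where
  "martingale M F Y \<longleftrightarrow>
     (\<forall>t\<ge>0. Y t \<in> borel_measurable (F t) \<and> integrable M (Y t)) \<and>
     (\<forall>s\<ge>0. \<forall>t\<ge>s. AE \<omega> in M. complex_cond_exp M (F s) (Y t) \<omega> = Y s \<omega>)"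

definition markov_process ::
    "'w measure \<Rightarrow> (real \<Rightarrow> 'w \<Rightarrow> 'x::topological_space) \<Rightarrow> (real \<Rightarrow> 'x \<Rightarrow> 'x measure) \<Rightarrow> bool" where
  "markov_process M X P \<longleftrightarrow>
     (\<forall>s\<ge>0. \<forall>t\<ge>s. \<forall>B\<in>sets borel.
        AE \<omega> in M. real_cond_exp M (canonical_filtration M X s) (\<lambda>\<omega>. indicator B (X t \<omega>)) \<omega> =
                   measure (P (t - s) (X s \<omega>)) B)"

definition Pi_process ::
    "(('x \<Rightarrow> complex) \<Rightarrow> 'x \<Rightarrow> complex) \<Rightarrow> ('x \<Rightarrow> complex) \<Rightarrow> (real \<Rightarrow> 'w \<Rightarrow> 'x) \<Rightarrow>
     real \<Rightarrow> 'w \<Rightarrow> complex" where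
  "Pi_process L f X t \<omega> = f (X t \<omega>) - f (X 0 \<omega>) - (LBINT s:{0..t}. L f (X s \<omega>))"

end

theory Submission
  imports Defs
begin

text \<open>
  Write \<open>\<F>\<^sub>s\<close> for the canonical filtration. Tested on events \<open>A \<in> \<F>\<^sub>s\<close>, the Markov property says that
  the law of \<open>X\<^sub>t\<close> restricted to \<open>A\<close> is the law of \<open>X\<^sub>s\<close> restricted to \<open>A\<close> composed with \<open>P\<^sub>t\<^sub>-\<^sub>s\<close>. The
  transform is injective on finite measures, because the inverse transforms are dense in \<open>C\<^sub>0\<close>; since
  \<open>P\<^sub>t\<^sub>-\<^sub>s\<close> multiplies \<open>\<phi>\<^sub>\<xi>\<close> by \<open>exp (- (t - s) \<psi> \<xi>)\<close>, this becomes
  \<open>E[\<phi>\<^sub>\<xi>(X\<^sub>t); A] = exp (- (t - s) \<psi> \<xi>) E[\<phi>\<^sub>\<xi>(X\<^sub>s); A]\<close> for all \<open>\<xi>\<close>, which is (2). By Fubini, (3) and (4)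
  say that \<open>m(t) = E[\<phi>\<^sub>\<xi>(X\<^sub>t); A]\<close> solves \<open>m(t) = m(s) - \<psi> \<integral>\<^sub>s\<^sup>t m\<close>, whose only solution is
  that exponential. Finally (1) implies (5) by Dynkin's formula along the laws of \<open>X\<^sub>r\<close> restricted to
  \<open>A\<close>, and (5) contains (4).
\<close>

section \<open>Locally compact second countable spaces\<close>

text \<open>Almost sure identities carry null sets that depend on a Borel set or on
  \<open>\<xi>\<close>, and there may be uncountably many of either. Testing on one event
  \<open>A\<close> at a time leaves identities between numbers, which can be collected over all
  \<open>\<xi>\<close>; this is why laws restricted to \<open>A\<close>, and not conditional
  distributions, are compared. Three obstacles shape the rest. X is not given with a metric, so
  measurability of pointwise limits, and from it the joint measurability of
  \<open>(s, \<omega>) \<mapsto> X s \<omega>\<close> that Fubini requires, is derived from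
  exhaustions of open sets. The dual space need not be second countable nor \<open>\<pi>\<close>
  \<sigma>-finite, so Fubini between \<open>\<pi>\<close> and a measure on X needs its own
  preparation. Weak continuity of the semigroup gives only continuity of
  \<open>t \<mapsto> transform \<phi> (P t e) \<xi>\<close>; that the limit defining
  \<open>\<psi>\<close> exists comes from integrating the functional equation once.\<close>

lemma Hausdorff_space_euclidean_t2: "Hausdorff_space (euclidean :: 'a::t2_space topology)"
  unfolding Hausdorff_space_def disjnt_def by simp (metis hausdorff)

lemma locally_compact_t2_open_nbhd:
  fixes U :: "'a::t2_space set"
  assumes "locally_compact_space (euclidean :: 'a topology)" "open U" "x \<in> U"
  obtains V where "open V" "x \<in> V" "compact (closure V)" "closure V \<subseteq> U"
proof -
  have "neighbourhood_base_of (\<lambda>C. compactin euclidean C \<and> closedin euclidean C) (euclidean :: 'a topology)"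
    using assms(1) locally_compact_space_neighbourhood_base_closedin Hausdorff_space_euclidean_t2
    by blast
  then obtain W C where "open W" "compact C" "closed C" "x \<in> W" "W \<subseteq> C" "C \<subseteq> U"
    unfolding neighbourhood_base_of using assms(2,3) by (auto simp: compactin_euclidean_iff) metis
  moreover have "closure W \<subseteq> C"
    using calculation by (simp add: closure_minimal)
  moreover have "compact (closure W)"
    using calculation by (metis closed_closure compact_Int_closed inf.absorb_iff2)
  ultimately show thesis using that by (meson order_trans)
qed

text \<open>Members of a countable basis whose closure is compact and contained in \<open>U\<close>
  already fill \<open>U\<close>, since every point of \<open>U\<close> has such a neighbourhood. The
  sequence is not increasing; finite unions are formed where monotonicity is wanted.\<close>

lemma locally_compact_t2_open_exhaustion:
  fixes U :: "'a::{second_countable_topology, t2_space} set"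
  assumes lc: "locally_compact_space (euclidean :: 'a topology)" and U: "open U"
  obtains V :: "nat \<Rightarrow> 'a set"
  where "\<And>n. open (V n)" "\<And>n. compact (closure (V n))" "\<And>n. closure (V n) \<subseteq> U" "(\<Union>n. V n) = U"
proof -
  obtain B :: "'a set set" where B: "countable B" "topological_basis B"
    using ex_countable_basis by blast
  \<comment> \<open>Adding the empty set keeps the family nonempty, so that
    \<open>from_nat_into\<close> enumerates exactly it even when \<open>U\<close> is empty.\<close>
  define \<V> where "\<V> = insert {} {b\<in>B. compact (closure b) \<and> closure b \<subseteq> U}"
  have c: "countable \<V>" "\<V> \<noteq> {}" using B(1) by (auto simp: \<V>_def)
  have rng: "range (from_nat_into \<V>) = \<V>" using c by (rule range_from_nat_into[rotated])
  have mem: "from_nat_into \<V> n \<in> \<V>" for n using c(2) by (rule from_nat_into)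
  have "\<Union>\<V> = U"
  proof
    show "\<Union>\<V> \<subseteq> U" using closure_subset by (fastforce simp: \<V>_def)
    show "U \<subseteq> \<Union>\<V>"
    proof
      fix x assume "x \<in> U"
      then obtain W where W: "open W" "x \<in> W" "compact (closure W)" "closure W \<subseteq> U"
        using locally_compact_t2_open_nbhd[OF lc U] by blast
      then obtain b where b: "b \<in> B" "x \<in> b" "b \<subseteq> W"
        using topological_basisE[OF B(2)] by metis
      then have "closure b \<subseteq> closure W" by (simp add: closure_mono)
      then have "compact (closure b)"
        using W(3) by (metis closed_closure compact_Int_closed inf.absorb_iff2)
      then show "x \<in> \<Union>\<V>" using b W \<open>closure b \<subseteq> closure W\<close> by (auto simp: \<V>_def)
    qed
  qed
  then have "(\<Union>n. from_nat_into \<V> n) = U" using rng by auto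
  moreover have "open v \<and> compact (closure v) \<and> closure v \<subseteq> U" if "v \<in> \<V>" for v
    using that topological_basis_open[OF B(2)] by (auto simp: \<V>_def)
  ultimately show thesis using that[of "from_nat_into \<V>"] mem by blast
qed

text \<open>A limit in \<open>U\<close> lies in some \<open>V n\<close>, so the sequence eventually
  stays there; conversely, a sequence that eventually stays in \<open>V n\<close> has its limit in
  \<open>closure (V n)\<close>, which is still inside \<open>U\<close>. The nested closures do the
  work of distances to the complement in a metric space.\<close>

lemma borel_measurable_pointwise_limit_locally_compact:
  fixes g :: "'w \<Rightarrow> 'a::{second_countable_topology, t2_space}"
  assumes lc: "locally_compact_space (euclidean :: 'a topology)"
    and f[measurable]: "\<And>n. f n \<in> borel_measurable M"
    and lim: "\<And>x. x \<in> space M \<Longrightarrow> (\<lambda>n. f n x) \<longlonglongrightarrow> g x"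
  shows "g \<in> borel_measurable M"
proof (rule borel_measurableI)
  fix U :: "'a set" assume U: "open U"
  from locally_compact_t2_open_exhaustion[OF lc U] obtain V :: "nat \<Rightarrow> 'a set" where
    V: "\<And>n. open (V n)" "\<And>n. closure (V n) \<subseteq> U" "(\<Union>n. V n) = U" by metis
  have [measurable]: "V n \<in> sets borel" for n using V(1) by simp
  have "g -` U \<inter> space M = {x\<in>space M. \<exists>n. \<exists>m. \<forall>k\<ge>m. f k x \<in> V n}"
  proof (intro set_eqI iffI)
    fix x assume x: "x \<in> g -` U \<inter> space M"
    then obtain n where "g x \<in> V n" using V(3) by auto
    then have "\<forall>\<^sub>F k in sequentially. f k x \<in> V n"
      using lim[of x] V(1) x by (auto simp: tendsto_def)
    then show "x \<in> {x\<in>space M. \<exists>n. \<exists>m. \<forall>k\<ge>m. f k x \<in> V n}"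
      using x by (auto simp: eventually_sequentially)
  next
    fix x assume "x \<in> {x\<in>space M. \<exists>n. \<exists>m. \<forall>k\<ge>m. f k x \<in> V n}"
    then obtain n m where x: "x \<in> space M" "\<forall>k\<ge>m. f k x \<in> V n" by auto
    have "g x \<in> closure (V n)"
    proof (rule Lim_in_closed_set[OF _ _ _ lim[OF x(1)]])
      show "\<forall>\<^sub>F k in sequentially. f k x \<in> closure (V n)"
        using x(2) closure_subset[of "V n"] unfolding eventually_sequentially by blast
    qed auto
    then show "x \<in> g -` U \<inter> space M" using V(2) x by auto
  qed
  also have "\<dots> \<in> sets M" by measurable
  finally show "g -` U \<inter> space M \<in> sets M" .
qed

text \<open>Clamping makes the path a function of all real times while involving only the variables
  \<open>X r\<close> with \<open>0 \<le> r \<le> t\<close>. With \<open>F\<close> the filtration at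
  time \<open>t\<close> this is progressive measurability, which makes path integrals adapted; with
  the full \<sigma>-algebra it is the joint measurability behind Fubini.\<close>

lemma right_continuous_progressively_measurable:
  fixes X :: "real \<Rightarrow> 'w \<Rightarrow> 'a::{second_countable_topology, t2_space}"
  assumes lc: "locally_compact_space (euclidean :: 'a topology)"
    and t: "0 \<le> t"
    and meas: "\<And>s. 0 \<le> s \<Longrightarrow> s \<le> t \<Longrightarrow> X s \<in> borel_measurable F"
    and rc: "\<And>s w. w \<in> space F \<Longrightarrow> 0 \<le> s \<Longrightarrow> ((\<lambda>r. X r w) \<longlongrightarrow> X s w) (at_right s)"
  shows "(\<lambda>(s, w). X (max 0 (min t s)) w) \<in> borel_measurable (borel \<Otimes>\<^sub>M F)"
proof -
  \<comment> \<open>Discretise time from above, so that right continuity gives the convergence.\<close>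
  define q :: "nat \<Rightarrow> int \<Rightarrow> real" where "q n i = (of_int i + 1) / real (Suc n)" for n i
  define c where "c = (\<lambda>s. max 0 (min t s))"
  have c: "0 \<le> c s" "c s \<le> t" for s using t by (auto simp: c_def)
  \<comment> \<open>Rounding up may leave \<open>[0, t]\<close>, where nothing is known about
    measurability; the outer \<open>c\<close> brings the time back. As \<open>c\<close> is monotone
    and fixes \<open>c s\<close>, the rounded time still lies at or above
    \<open>c s\<close>.\<close>
  define d where "d = (\<lambda>n s. c (q n \<lfloor>real (Suc n) * c s\<rfloor>))"
  have fl: "a \<le> q n \<lfloor>real (Suc n) * a\<rfloor>" "q n \<lfloor>real (Suc n) * a\<rfloor> \<le> a + 1 / real (Suc n)" for n a
  proof -
    have "real (Suc n) * a \<le> of_int \<lfloor>real (Suc n) * a\<rfloor> + 1" by linarith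
    then show "a \<le> q n \<lfloor>real (Suc n) * a\<rfloor>" by (simp add: q_def field_simps)
    have "q n \<lfloor>real (Suc n) * a\<rfloor> \<le> (real (Suc n) * a + 1) / real (Suc n)"
      unfolding q_def by (intro divide_right_mono) auto
    also have "\<dots> = a + 1 / real (Suc n)" by (simp only: add_divide_distrib) simp
    finally show "q n \<lfloor>real (Suc n) * a\<rfloor> \<le> a + 1 / real (Suc n)" .
  qed
  have d: "c s \<le> d n s" "d n s \<le> c s + 1 / real (Suc n)" for n :: nat and s
    using fl[where a="c s" and n=n] c[of s] unfolding d_def by (auto simp: c_def)
  have "(\<lambda>(s, w). X (d n s) w) \<in> borel_measurable (borel \<Otimes>\<^sub>M F)" for n
  proof -
    have "(\<lambda>p. X (c (q n i)) (snd p)) \<in> borel_measurable (borel \<Otimes>\<^sub>M F)" for i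
      using meas[OF c, of "q n i"] by measurable
    moreover have "(\<lambda>p. \<lfloor>real (Suc n) * c (fst p)\<rfloor>) \<in> (borel \<Otimes>\<^sub>M F) \<rightarrow>\<^sub>M count_space UNIV"
      unfolding c_def by measurable
    ultimately have "(\<lambda>p. X (c (q n \<lfloor>real (Suc n) * c (fst p)\<rfloor>)) (snd p)) \<in> borel_measurable (borel \<Otimes>\<^sub>M F)"
      by (rule measurable_compose_countable)
    then show ?thesis by (simp add: d_def split_beta')
  qed
  moreover have "(\<lambda>n. (\<lambda>(s, w). X (d n s) w) p) \<longlonglongrightarrow> (\<lambda>(s, w). X (c s) w) p"
    if p: "p \<in> space (borel \<Otimes>\<^sub>M F)" for p
  proof -
    obtain s w where sw: "p = (s, w)" by (cases p)
    have w: "w \<in> space F" using p sw by (simp add: space_pair_measure)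
    have "(\<lambda>n. d n s) \<longlonglongrightarrow> c s"
    proof (rule tendsto_sandwich)
      show "(\<lambda>n. c s) \<longlonglongrightarrow> c s" by simp
      show "(\<lambda>n. c s + 1 / real (Suc n)) \<longlonglongrightarrow> c s"
        using tendsto_add[OF tendsto_const LIMSEQ_inverse_real_of_nat, of "c s"]
        by (simp add: inverse_eq_divide)
    qed (use d in \<open>simp_all del: of_nat_Suc\<close>)
    \<comment> \<open>\<open>at_right\<close> excludes the point itself, but
      \<open>d n s = c s\<close> does occur, for instance when \<open>c s = t\<close>. Continuity
      within the closed half-line admits this case.\<close>
    moreover have "continuous (at (c s) within {c s..}) (\<lambda>r. X r w)"
      using rc[OF w c(1)] by (simp add: continuous_within at_within_Ici_at_right)
    ultimately have "(\<lambda>n. X (d n s) w) \<longlonglongrightarrow> X (c s) w"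
      using d(1) by (intro continuous_within_tendsto_compose[where f="\<lambda>r. X r w"]) auto
    then show ?thesis by (simp add: sw)
  qed
  ultimately have "(\<lambda>(s, w). X (c s) w) \<in> borel_measurable (borel \<Otimes>\<^sub>M F)"
    by (rule borel_measurable_pointwise_limit_locally_compact[OF lc])
  then show ?thesis by (simp add: c_def)
qed

text \<open>
  Only one factor needs to be second countable, although the Borel sets of the product may then be a
  larger \<open>\<sigma>\<close>-algebra than the product of the Borel sets.
\<close>

lemma borel_measurable_pair_continuous:
  fixes f :: "'l::topological_space \<times> 'x::second_countable_topology \<Rightarrow> 'b::topological_space"
  assumes "continuous_on UNIV f"
  shows "f \<in> borel_measurable (borel \<Otimes>\<^sub>M borel)"
proof (rule borel_measurableI)
  fix S :: "'b set" assume S: "open S"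
  have op: "open (f -` S)" using assms S by (simp add: continuous_on_open_vimage)
  obtain B :: "'x set set" where B: "countable B" "topological_basis B"
    using ex_countable_basis by blast
  \<comment> \<open>\<open>W V\<close> is the largest open set whose product with \<open>V\<close>
    stays in the preimage. The union over all admissible \<open>U\<close>, however many, is again
    open; only the index \<open>V\<close> has to run through a countable family.\<close>
  define W where "W V = \<Union>{U. open U \<and> U \<times> V \<subseteq> f -` S}" for V
  have "f -` S = (\<Union>V\<in>B. W V \<times> V)"
  proof
    show "(\<Union>V\<in>B. W V \<times> V) \<subseteq> f -` S" by (auto simp: W_def)
    show "f -` S \<subseteq> (\<Union>V\<in>B. W V \<times> V)"
    proof
      fix p assume "p \<in> f -` S"
      then obtain U V where UV: "open U" "open V" "p \<in> U \<times> V" "U \<times> V \<subseteq> f -` S"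
        using open_prod_elim[OF op] by metis
      then obtain b where b: "b \<in> B" "snd p \<in> b" "b \<subseteq> V"
        using topological_basisE[OF B(2) UV(2), of "snd p"] by (auto simp: mem_Times_iff)
      have "U \<times> b \<subseteq> f -` S" using UV(4) b(3) by blast
      then have "fst p \<in> W b" using UV(1,3) unfolding W_def by (auto simp: mem_Times_iff)
      then show "p \<in> (\<Union>V\<in>B. W V \<times> V)" using b by (intro UN_I[of b]) (auto simp: mem_Times_iff)
    qed
  qed
  also have "\<dots> \<in> sets (borel \<Otimes>\<^sub>M borel)"
  proof (rule sets.countable_UN'[OF B(1)], rule image_subsetI)
    fix V assume "V \<in> B"
    then have "open V" using B(2) by (rule topological_basis_open[rotated])
    moreover have "open (W V)" by (auto simp: W_def)
    ultimately show "W V \<times> V \<in> sets (borel \<Otimes>\<^sub>M borel)" by (intro pair_measureI) auto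
  qed
  finally have "f -` S \<in> sets (borel \<Otimes>\<^sub>M borel)" .
  then show "f -` S \<inter> space (borel \<Otimes>\<^sub>M borel) \<in> sets (borel \<Otimes>\<^sub>M borel)"
    by (simp add: space_pair_measure)
qed

text \<open>A Urysohn function \<open>f\<close> between the indicators of a compact
  \<open>K n\<close> and of \<open>U\<close> gives \<open>\<mu>(K n) \<le> \<integral> f d\<mu> =
  \<integral> f d\<nu> \<le> \<nu>(U)\<close>, and the sets \<open>K n\<close> increase to
  \<open>U\<close>. One inequality suffices because the hypotheses are symmetric in the two
  measures.\<close>

lemma emeasure_open_le_if_C0_integrals_eq:
  fixes \<mu> \<nu> :: "'x::{second_countable_topology, t2_space} measure"
  assumes lc: "locally_compact_space (euclidean :: 'x topology)"
    and fin: "finite_measure \<mu>" "finite_measure \<nu>"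
    and sets: "sets \<mu> = sets borel" "sets \<nu> = sets borel"
    and eq: "\<And>g. g \<in> C0 \<Longrightarrow> integral\<^sup>L \<mu> g = integral\<^sup>L \<nu> g"
    and U: "open U"
  shows "emeasure \<mu> U \<le> emeasure \<nu> U"
proof -
  interpret mu: finite_measure \<mu> by fact
  interpret nu: finite_measure \<nu> by fact
  have [simp]: "space \<mu> = UNIV" "space \<nu> = UNIV" using sets by (auto dest: sets_eq_imp_space_eq)
  obtain V :: "nat \<Rightarrow> 'x set" where V: "\<And>n. open (V n)" "\<And>n. compact (closure (V n))"
      "\<And>n. closure (V n) \<subseteq> U" "(\<Union>n. V n) = U"
    using locally_compact_t2_open_exhaustion[OF lc U] by metis
  \<comment> \<open>The open sets \<open>W n\<close> sit inside the compact sets \<open>K n\<close>.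
    By compactness \<open>K n\<close> lies in some \<open>W m\<close>, and a function vanishing off
    \<open>W m\<close> vanishes off the compact set \<open>K m\<close>, which puts it in
    \<open>C0\<close> once it is continuous.\<close>
  define K where "K n = (\<Union>i\<le>n. closure (V i))" for n
  define W where "W n = (\<Union>i\<le>n. V i)" for n
  have K: "compact (K n)" "K n \<subseteq> U" for n using V(2,3) by (auto simp: K_def simp del: UN_simps)
  have W: "open (W n)" "W n \<subseteq> K n" for n
    using V(1) unfolding K_def W_def by (intro open_UN ballI UN_mono closure_subset order_refl; simp)+
  have "emeasure \<mu> (K n) \<le> emeasure \<nu> U" for n
  proof -
    have "K n \<subseteq> (\<Union>i\<in>UNIV. W i)" using K(2) V(4) by (fastforce simp: W_def)
    then obtain S where S: "finite S" "K n \<subseteq> (\<Union>i\<in>S. W i)"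
      using compactE_image[OF K(1), of UNIV W] W(1) by metis
    define m where "m = Max (insert 0 S)"
    have "(\<Union>i\<in>S. W i) \<subseteq> W m"
    proof (rule UN_least)
      fix i assume "i \<in> S"
      then have "i \<le> m" using S(1) by (simp add: m_def)
      then show "W i \<subseteq> W m" by (force simp: W_def)
    qed
    then have KW: "K n \<subseteq> W m" using S by blast
    have "completely_regular_space (euclidean :: 'x topology)"
      using lc Hausdorff_space_euclidean_t2 locally_compact_Hausdorff_imp_regular_space
        locally_compact_regular_imp_completely_regular_space by blast
    moreover have "compactin euclidean (K n)" "closedin euclidean (- W m)"
      using K W by (auto simp: compactin_euclidean_iff)
    moreover have "disjnt (K n) (- W m)" using KW by (auto simp: disjnt_def)
    ultimately obtain f :: "'x \<Rightarrow> real" where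
      f: "continuous_map euclidean (top_of_set {0..1}) f" "f ` (- W m) \<subseteq> {0}" "f ` K n \<subseteq> {1}"
      using Urysohn_completely_regular_compact_closed[of 0 1 euclidean "K n" "- W m"] by auto
    have fc: "continuous_on UNIV f" and f01: "\<And>x. 0 \<le> f x \<and> f x \<le> 1"
      using f(1) by (auto simp: continuous_map_in_subtopology Pi_iff)
    have [measurable]: "f \<in> borel_measurable borel" using fc by (rule borel_measurable_continuous_onI)
    have mf: "f \<in> borel_measurable \<mu>" "f \<in> borel_measurable \<nu>"
      by (simp_all cong: measurable_cong_sets add: sets)
    have int: "integrable \<mu> f" "integrable \<nu> f"
      using f01 mf by (auto intro!: mu.integrable_const_bound[where B=1] nu.integrable_const_bound[where B=1])
    have Uset: "K n \<in> sets borel" "U \<in> sets borel"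
      using K(1) U by (auto intro: borel_compact)
    have "(\<lambda>x. complex_of_real (f x)) \<in> C0"
      unfolding C0_def
    proof (intro CollectI conjI allI impI)
      show "continuous_on UNIV (\<lambda>x. complex_of_real (f x))" using fc by (intro continuous_intros)
      fix \<epsilon> :: real assume "\<epsilon> > 0"
      then show "\<exists>K. compact K \<and> (\<forall>x. x \<notin> K \<longrightarrow> cmod (complex_of_real (f x)) < \<epsilon>)"
        using K(1) f(2) W(2) by (intro exI[of _ "K m"]) fastforce
    qed
    from eq[OF this] have fe: "integral\<^sup>L \<mu> f = integral\<^sup>L \<nu> f" by simp
    have "measure \<mu> (K n) = (\<integral>x. indicator (K n) x \<partial>\<mu>)" by simp
    also have "\<dots> \<le> integral\<^sup>L \<mu> f"
    proof (rule integral_mono[OF _ int(1)])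
      show "integrable \<mu> (indicator (K n) :: _ \<Rightarrow> real)"
        using Uset by (simp add: sets mu.emeasure_eq_measure)
      fix x show "indicator (K n) x \<le> f x"
        using f01[of x] f(3) by (cases "x \<in> K n") auto
    qed
    also have "\<dots> = integral\<^sup>L \<nu> f" by (rule fe)
    also have "\<dots> \<le> (\<integral>x. indicator U x \<partial>\<nu>)"
    proof (rule integral_mono[OF int(2)])
      show "integrable \<nu> (indicator U :: _ \<Rightarrow> real)" using Uset by (simp add: sets nu.emeasure_eq_measure)
      fix x show "f x \<le> indicator U x"
        using f01[of x] f(2) subsetD[OF W(2)[of m]] subsetD[OF K(2)[of m]]
        by (cases "x \<in> U") (auto simp: image_subset_iff)
    qed
    also have "\<dots> = measure \<nu> U" by simp
    finally show ?thesis by (simp add: mu.emeasure_eq_measure nu.emeasure_eq_measure)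
  qed
  moreover have "emeasure \<mu> U = (SUP n. emeasure \<mu> (K n))"
  proof -
    have "V n \<subseteq> K n" for n
      using W(2)[of n] by (auto simp: W_def)
    then have "(\<Union>n. K n) = U" using K(2) V(4) by blast
    moreover have "incseq K" unfolding K_def incseq_def by (intro allI impI UN_mono) auto
    moreover have "range K \<subseteq> sets \<mu>" using K(1) by (auto simp: sets intro: borel_compact)
    ultimately show ?thesis using SUP_emeasure_incseq[of K \<mu>] by simp
  qed
  ultimately show ?thesis by (simp add: SUP_least)
qed

lemma finite_measure_eqI_C0:
  fixes \<mu> \<nu> :: "'x::{second_countable_topology, t2_space} measure"
  assumes lc: "locally_compact_space (euclidean :: 'x topology)"
    and fin: "finite_measure \<mu>" "finite_measure \<nu>"
    and sets: "sets \<mu> = sets borel" "sets \<nu> = sets borel"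
    and eq: "\<And>g. g \<in> C0 \<Longrightarrow> integral\<^sup>L \<mu> g = integral\<^sup>L \<nu> g"
  shows "\<mu> = \<nu>"
proof (rule measure_eqI_generator_eq)
  show "Int_stable {U :: 'x set. open U}" by (auto simp: Int_stable_def)
  show "{U :: 'x set. open U} \<subseteq> Pow UNIV" by simp
  show "sets \<mu> = sigma_sets UNIV {U. open U}" "sets \<nu> = sigma_sets UNIV {U. open U}"
    by (simp_all add: sets sets_borel)
  show "range (\<lambda>i::nat. UNIV :: 'x set) \<subseteq> {U. open U}" by auto
  show "emeasure \<mu> UNIV \<noteq> \<infinity>" for i :: nat
    using finite_measure.emeasure_finite[OF fin(1), of UNIV] by simp
  fix U :: "'x set" assume "U \<in> {U. open U}"
  then show "emeasure \<mu> U = emeasure \<nu> U"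
    using emeasure_open_le_if_C0_integrals_eq[OF lc fin sets eq]
      emeasure_open_le_if_C0_integrals_eq[OF lc fin(2,1) sets(2,1) eq[symmetric]]
    by (simp add: antisym)
qed auto

section \<open>Difference quotients and linear integral equations\<close>

text \<open>
  Uniformity in \<open>r\<close> makes the limit of the forward difference quotients continuous, so that the
  right derivative is also a left derivative.
\<close>

lemma uniform_forward_difference_quotient_integral:
  fixes u v :: "real \<Rightarrow> complex"
  assumes lim: "uniform_limit {0..} (\<lambda>h r. (u (r + h) - u r) / complex_of_real h) v (at_right 0)"
    and bdd: "\<And>r. 0 \<le> r \<Longrightarrow> cmod (v r) \<le> C"
  shows "continuous_on {0..} v"
    and "0 \<le> t \<Longrightarrow> (v has_integral (u t - u 0)) {0..t}"
proof -
  have D: "\<exists>d>0. \<forall>h r. 0 \<le> h \<longrightarrow> h < d \<longrightarrow> 0 \<le> r \<longrightarrow> cmod (u (r + h) - u r - h *\<^sub>R v r) \<le> h * e"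
    if e: "e > 0" for e
  proof -
    from uniform_limitD[OF lim e] obtain d where "d > 0" and
      d: "\<And>h r. 0 < h \<Longrightarrow> h < d \<Longrightarrow> 0 \<le> r \<Longrightarrow> dist ((u (r + h) - u r) / complex_of_real h) (v r) < e"
      unfolding eventually_at_right_field by auto
    have "cmod (u (r + h) - u r - h *\<^sub>R v r) \<le> h * e" if "0 \<le> h" "h < d" "0 \<le> r" for h r
    proof (cases "h = 0")
      case False
      then have h: "h > 0" using that by simp
      have "u (r + h) - u r - h *\<^sub>R v r = h *\<^sub>R ((u (r + h) - u r) / complex_of_real h - v r)"
        using h by (simp add: scaleR_conv_of_real field_simps)
      then have "cmod (u (r + h) - u r - h *\<^sub>R v r) = h * cmod ((u (r + h) - u r) / complex_of_real h - v r)"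
        using h by simp
      also have "\<dots> \<le> h * e"
        using d[OF h that(2,3)] h by (intro mult_left_mono) (auto simp: dist_norm)
      finally show ?thesis .
    qed simp
    then show ?thesis using \<open>d > 0\<close> by blast
  qed
  have C: "0 \<le> C" using bdd[of 0] norm_ge_zero order_trans by blast
  \<comment> \<open>The quotients are continuous in \<open>r\<close> once \<open>u\<close> is. Error
    1 in the expansion plus the bound \<open>C\<close> on \<open>v\<close> gives the Lipschitz
    constant \<open>C + 1\<close> for increments shorter than \<open>d\<close>.\<close>
  have ucont: "continuous_on {0..} u"
  proof -
    obtain d where d: "d > 0" "\<And>h r. 0 \<le> h \<Longrightarrow> h < d \<Longrightarrow> 0 \<le> r \<Longrightarrow> cmod (u (r + h) - u r - h *\<^sub>R v r) \<le> h * 1"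
      using D[of 1] by auto
    have inc: "cmod (u y - u x) \<le> (y - x) * (C + 1)" if "0 \<le> x" "x \<le> y" "y - x < d" for x y
    proof -
      have "cmod (u y - u x) \<le> cmod (u (x + (y - x)) - u x - (y - x) *\<^sub>R v x) + cmod ((y - x) *\<^sub>R v x)"
        using norm_triangle_sub[of "u y - u x" "(y - x) *\<^sub>R v x"] by simp
      also have "\<dots> \<le> (y - x) * 1 + (y - x) * C"
        using d(2)[of "y - x" x] bdd[of x] that by (intro add_mono) (auto intro!: mult_left_mono)
      finally show ?thesis by (simp add: algebra_simps)
    qed
    have inc': "cmod (u y - u x) \<le> \<bar>y - x\<bar> * (C + 1)" if "0 \<le> x" "0 \<le> y" "\<bar>y - x\<bar> < d" for x y
      using inc[of x y] inc[of y x] that by (cases "x \<le> y") (auto simp: norm_minus_commute)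
    show ?thesis
      unfolding continuous_on_iff
    proof (intro ballI allI impI)
      fix x e :: real assume x: "x \<in> {0..}" and e: "0 < e"
      show "\<exists>d>0. \<forall>x'\<in>{0..}. dist x' x < d \<longrightarrow> dist (u x') (u x) < e"
      proof (intro exI conjI ballI impI)
        show "min d (e / (C + 1)) > 0" using d(1) e C by simp
        fix y assume y: "y \<in> {0..}" "dist y x < min d (e / (C + 1))"
        then have "\<bar>y - x\<bar> * (C + 1) < e" using C by (simp add: dist_real_def field_simps)
        then show "dist (u y) (u x) < e"
          using inc'[of x y] x y by (auto simp: dist_norm)
      qed
    qed
  qed
  show vcont: "continuous_on {0..} v"
  proof (rule uniform_limit_theorem[OF _ lim])
    show "\<forall>\<^sub>F h in at_right 0. continuous_on {0..} (\<lambda>r. (u (r + h) - u r) / complex_of_real h)"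
    proof (rule eventually_at_rightI[of 0 1])
      fix h :: real assume h: "h \<in> {0<..<1}"
      have "continuous_on {0..} (\<lambda>r. u (r + h))"
        using h by (intro continuous_on_compose2[OF ucont] continuous_intros) auto
      then show "continuous_on {0..} (\<lambda>r. (u (r + h) - u r) / complex_of_real h)"
        using h ucont by (intro continuous_intros) auto
    qed simp
  qed simp
  assume t: "0 \<le> t"
  have "(u has_vector_derivative v x) (at x)" if x: "0 < x" for x
    unfolding has_vector_derivative_def has_derivative_at_alt
  proof (intro conjI allI impI bounded_linear_scaleR_left)
    fix e :: real assume e: "0 < e"
    obtain d1 where d1: "d1 > 0" "\<And>h r. 0 \<le> h \<Longrightarrow> h < d1 \<Longrightarrow> 0 \<le> r \<Longrightarrow> cmod (u (r + h) - u r - h *\<^sub>R v r) \<le> h * (e/2)"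
      using D[of "e/2"] e by auto
    obtain d2 where d2: "d2 > 0" "\<And>y. 0 \<le> y \<Longrightarrow> \<bar>y - x\<bar> < d2 \<Longrightarrow> cmod (v y - v x) < e/2"
    proof -
      have "x \<in> {0..}" "e/2 > 0" using x e by auto
      then obtain d2 where "d2 > 0" "\<forall>y\<in>{0..}. dist y x < d2 \<longrightarrow> dist (v y) (v x) < e/2"
        using vcont unfolding continuous_on_iff by meson
      then show thesis using that by (auto simp: dist_norm)
    qed
    show "\<exists>d>0. \<forall>y. norm (y - x) < d \<longrightarrow> cmod (u y - u x - (y - x) *\<^sub>R v x) \<le> e * norm (y - x)"
    proof (intro exI conjI allI impI)
      show "min x (min d1 d2) > 0" using x d1 d2 by simp
      fix y assume y: "norm (y - x) < min x (min d1 d2)"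
      show "cmod (u y - u x - (y - x) *\<^sub>R v x) \<le> e * norm (y - x)"
      proof (cases "x \<le> y")
        case True
        have "cmod (u (x + (y - x)) - u x - (y - x) *\<^sub>R v x) \<le> (y - x) * (e/2)"
          using True y x by (intro d1) auto
        also have "\<dots> \<le> e * norm (y - x)" using True e by (simp add: field_simps)
        finally show ?thesis by simp
      next
        case False
        \<comment> \<open>To the left of \<open>x\<close> the expansion is based at
          \<open>y\<close>, from which \<open>x\<close> is a forward step; exchanging
          \<open>v y\<close> for \<open>v x\<close> is paid for by continuity of \<open>v\<close>.
          Each of the two errors is at most \<open>(x - y) * (e/2)\<close>.\<close>
        have eq: "u y - u x - (y - x) *\<^sub>R v x = (x - y) *\<^sub>R (v x - v y) - (u (y + (x - y)) - u y - (x - y) *\<^sub>R v y)"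
          by (simp add: algebra_simps)
        have "cmod (u y - u x - (y - x) *\<^sub>R v x)
            \<le> cmod ((x - y) *\<^sub>R (v x - v y)) + cmod (u (y + (x - y)) - u y - (x - y) *\<^sub>R v y)"
          unfolding eq by (rule norm_triangle_ineq4)
        also have "\<dots> \<le> (x - y) * (e/2) + (x - y) * (e/2)"
        proof (intro add_mono d1)
          show "cmod ((x - y) *\<^sub>R (v x - v y)) \<le> (x - y) * (e / 2)"
            using d2(2)[of y] y False
            by (auto simp: norm_minus_commute intro!: mult_left_mono)
        qed (use False y in auto)
        also have "\<dots> = e * norm (y - x)" using False by (simp add: field_simps)
        finally show ?thesis .
      qed
    qed
  qed
  then show "(v has_integral (u t - u 0)) {0..t}"
    using t by (intro fundamental_theorem_of_calculus_interior continuous_on_subset[OF ucont]) auto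
qed

text \<open>The equation itself improves regularity: \<open>m\<close> is only integrable at the
  outset, but its indefinite integral \<open>J\<close> is continuous, hence so is
  \<open>m = m s - \<psi> * J\<close>, hence \<open>J\<close> is differentiable. The integrating
  factor \<open>exp ((r - s) * \<psi>)\<close> then turns \<open>m\<close> into a constant.
  Integrability is what Fubini provides for expectations along paths.\<close>

lemma linear_integral_equation_unique:
  fixes m :: "real \<Rightarrow> complex"
  assumes t: "s \<le> t"
    and int: "set_integrable lborel {s..t} m"
    and eq: "\<And>r. s \<le> r \<Longrightarrow> r \<le> t \<Longrightarrow> m r = m s - \<psi> * (LBINT q:{s..r}. m q)"
  shows "m t = exp (- (complex_of_real (t - s) * \<psi>)) * m s"
proof -
  define J where "J r = integral {s..r} m" for r
  have sub: "set_integrable lborel {s..r} m" if "r \<le> t" for r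
    using that by (intro set_integrable_subset[OF int]) auto
  have eqJ: "m r = m s - \<psi> * J r" if "r \<in> {s..t}" for r
    using eq[of r] set_borel_integral_eq_integral(2)[OF sub, of r] that by (simp add: J_def)
  have "m integrable_on {s..t}" using set_borel_integral_eq_integral(1)[OF int] .
  then have "continuous_on {s..t} J" unfolding J_def by (rule indefinite_integral_continuous_1)
  then have "continuous_on {s..t} (\<lambda>r. m s - \<psi> * J r)" by (intro continuous_intros)
  then have mcont: "continuous_on {s..t} m"
    by (rule continuous_on_eq) (rule eqJ[symmetric])
  define E where "E r = exp (complex_of_real (r - s) * \<psi>)" for r
  have E': "(E has_vector_derivative (\<psi> * E r)) (at r within {s..t})" for r
  proof -
    have "((\<lambda>z. exp ((z - of_real s) * \<psi>)) has_field_derivative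
        exp ((of_real r - of_real s) * \<psi>) * ((1 - 0) * \<psi>)) (at (complex_of_real r))"
      by (rule DERIV_fun_exp DERIV_cmult_right DERIV_diff DERIV_ident DERIV_const)+
    from has_vector_derivative_real_field[OF this, of "{s..t}"] show ?thesis
      unfolding E_def of_real_diff by (simp add: mult.commute)
  qed
  \<comment> \<open>On the interval \<open>m s - \<psi> * J r\<close> equals \<open>m r\<close>; in
    this form its derivative is visibly \<open>- \<psi> * m r\<close>, and the derivative
    \<open>\<psi> * E r\<close> of the other factor cancels it in the product rule.\<close>
  have "((\<lambda>r. E r * (m s - \<psi> * J r)) has_vector_derivative 0) (at r within {s..t})" if r: "r \<in> {s..t}" for r
  proof -
    have J': "(J has_vector_derivative m r) (at r within {s..t})"
      unfolding J_def by (rule integral_has_vector_derivative[OF mcont r])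
    have "((\<lambda>r. E r * (m s - \<psi> * J r)) has_vector_derivative
        (E r * (0 - \<psi> * m r) + \<psi> * E r * (m s - \<psi> * J r))) (at r within {s..t})"
      by (rule has_vector_derivative_mult[OF E' has_vector_derivative_diff[OF has_vector_derivative_const
            has_vector_derivative_mult_right[OF J']]])
    then show ?thesis using eqJ[OF r] by simp
  qed
  then have "E t * (m s - \<psi> * J t) = E s * (m s - \<psi> * J s)"
    using t by (intro has_derivative_zero_unique[of "{s..t}" "\<lambda>r. E r * (m s - \<psi> * J r)"])
      (auto simp: has_vector_derivative_def)
  moreover have "J s = 0" by (simp add: J_def)
  moreover have "m s - \<psi> * J t = m t" using eqJ[of t] t by simp
  ultimately have "E t * m t = m s" by (simp add: E_def)
  moreover have "exp (- z) * (exp z * w) = w" for z w :: complex by (simp add: exp_minus)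
  ultimately show ?thesis unfolding E_def by metis
qed

section \<open>Continuous multiplicative functions of nonnegative time are exponentials\<close>

lemma right_difference_quotient_tendsto:
  fixes G :: "real \<Rightarrow> complex"
  assumes G: "(G has_vector_derivative G') (at x within {a..b})" and x: "a \<le> x" "x < b"
  shows "((\<lambda>h. (G (x + h) - G x) / complex_of_real h) \<longlongrightarrow> G') (at_right 0)"
proof (rule tendstoI)
  fix e :: real assume "e > 0"
  then obtain d where d: "d > 0" "\<And>y. y \<in> {a..b} \<Longrightarrow> \<bar>y - x\<bar> < d \<Longrightarrow> cmod (G y - G x - (y - x) *\<^sub>R G') \<le> e/2 * \<bar>y - x\<bar>"
    using G unfolding has_vector_derivative_def has_derivative_within_alt by (auto dest: spec[of _ "e/2"])
  show "\<forall>\<^sub>F h in at_right 0. dist ((G (x + h) - G x) / complex_of_real h) G' < e"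
  proof (rule eventually_at_rightI[of 0 "min d (b - x)"])
    fix h assume h: "h \<in> {0<..<min d (b - x)}"
    have "(G (x + h) - G x) / complex_of_real h - G' = (G (x + h) - G x - h *\<^sub>R G') / complex_of_real h"
      using h by (simp add: scaleR_conv_of_real field_simps)
    then have "dist ((G (x + h) - G x) / complex_of_real h) G' = cmod (G (x + h) - G x - h *\<^sub>R G') / h"
      using h by (simp add: dist_norm norm_divide)
    also have "\<dots> \<le> e / 2" using d(2)[of "x + h"] h x by (simp add: field_simps)
    finally show "dist ((G (x + h) - G x) / complex_of_real h) G' < e" using \<open>e > 0\<close> by simp
  qed (use d x in auto)
qed

text \<open>Integrating the functional equation over \<open>[0, a]\<close> transfers
  differentiability from the primitive \<open>G\<close> to \<open>g\<close>, provided
  \<open>G a\<close> is nonzero. The slope at 0 spreads to every \<open>r\<close> by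
  multiplicativity, uniformly because \<open>cmod (g r) \<le> 1\<close>, and the resulting integral
  equation has the exponential as its only solution with value 1 at 0.\<close>

lemma continuous_multiplicative_imp_exp:
  fixes g :: "real \<Rightarrow> complex"
  assumes cont: "continuous_on {0..} g" and g0: "g 0 = 1"
    and mult: "\<And>s t. 0 \<le> s \<Longrightarrow> 0 \<le> t \<Longrightarrow> g (s + t) = g s * g t"
    and bdd: "\<And>t. 0 \<le> t \<Longrightarrow> cmod (g t) \<le> 1"
  obtains \<psi> where "((\<lambda>h. (1 - g h) / complex_of_real h) \<longlongrightarrow> \<psi>) (at_right 0)"
    and "\<And>t. 0 \<le> t \<Longrightarrow> g t = exp (- (complex_of_real t * \<psi>))"
proof -
  define G where "G t = integral {0..t} g" for t
  have gc: "continuous_on {a..b} g" if "0 \<le> a" for a b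
    using that by (intro continuous_on_subset[OF cont]) auto
  have G': "(G has_vector_derivative g x) (at x within {0..b})" if "x \<in> {0..b}" for x b
    unfolding G_def using that by (intro integral_has_vector_derivative gc) auto
  \<comment> \<open>A primitive vanishing at all positive times would have right derivative 0 at 0,
    whereas that derivative is \<open>g 0 = 1\<close>.\<close>
  obtain a where a: "a > 0" "G a \<noteq> 0"
  proof (rule ccontr)
    assume "\<not> thesis"
    then have z: "G x = 0" if "x > 0" for x using that \<open>\<And>a. 0 < a \<Longrightarrow> G a \<noteq> 0 \<Longrightarrow> thesis\<close> by blast
    moreover have "G 0 = 0" by (simp add: G_def)
    ultimately have "\<forall>\<^sub>F h in at_right 0. (G (0 + h) - G 0) / complex_of_real h = 0"
      by (intro eventually_at_rightI[of 0 1]) auto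
    then have "((\<lambda>h. (G (0 + h) - G 0) / complex_of_real h) \<longlongrightarrow> 0) (at_right 0)"
      by (rule tendsto_eventually)
    moreover have "((\<lambda>h. (G (0 + h) - G 0) / complex_of_real h) \<longlongrightarrow> g 0) (at_right 0)"
      using G'[of 0 1] by (intro right_difference_quotient_tendsto[of G _ 0 0 1]) auto
    ultimately have "g 0 = 0" using tendsto_unique trivial_limit_at_right_real by blast
    then show False using g0 by simp
  qed
  have shift: "G (a + h) - G h = G a * g h" if h: "0 \<le> h" for h
  proof -
    have "integral {0..h} g + integral {h..a + h} g = integral {0..a + h} g"
      using h a by (intro Henstock_Kurzweil_Integration.integral_combine integrable_continuous_real gc) auto
    moreover have "integral {h..a + h} g = integral {0..a} (\<lambda>x. g (x + h))"
      using integral_shift_cbox_plus[of 0 a g h] by (simp add: o_def add.commute)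
    moreover have "integral {0..a} (\<lambda>x. g (x + h)) = integral {0..a} (\<lambda>x. g x * g h)"
      using h by (intro integral_cong) (simp add: mult)
    ultimately show ?thesis by (simp add: G_def algebra_simps)
  qed
  \<comment> \<open>The identity \<open>G (a + h) - G h = G a * g h\<close> makes \<open>g\<close> differentiable at \<open>0\<close>, with this slope.\<close>
  define \<psi> where "\<psi> = (1 - g a) / G a"
  have lim: "((\<lambda>h. (1 - g h) / complex_of_real h) \<longlongrightarrow> \<psi>) (at_right 0)"
  proof -
    have "((\<lambda>h. ((G (0 + h) - G 0) / complex_of_real h - (G (a + h) - G a) / complex_of_real h) / G a)
        \<longlongrightarrow> (g 0 - g a) / G a) (at_right 0)"
      using G'[of 0 1] G'[of a "a + 1"] a
      by (intro tendsto_divide tendsto_diff tendsto_const right_difference_quotient_tendsto[of G _ 0 0 1]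
          right_difference_quotient_tendsto[of G _ a 0 "a + 1"]) auto
    moreover have "\<forall>\<^sub>F h in at_right 0. ((G (0 + h) - G 0) / complex_of_real h
        - (G (a + h) - G a) / complex_of_real h) / G a = (1 - g h) / complex_of_real h"
    proof (rule eventually_at_rightI[of 0 1])
      fix h :: real assume h: "h \<in> {0<..<1}"
      have "G (a + h) = G h + G a * g h" using shift[of h] h by (simp add: algebra_simps)
      moreover have "G 0 = 0" by (simp add: G_def)
      ultimately show "((G (0 + h) - G 0) / complex_of_real h
        - (G (a + h) - G a) / complex_of_real h) / G a = (1 - g h) / complex_of_real h"
        using a h by (simp add: field_simps)
    qed simp
    ultimately show ?thesis unfolding \<psi>_def g0 by (rule Lim_transform_eventually)
  qed
  have "uniform_limit {0..} (\<lambda>h r. (g (r + h) - g r) / complex_of_real h) (\<lambda>r. - \<psi> * g r) (at_right 0)"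
  proof (rule uniform_limitI)
    fix e :: real assume e: "e > 0"
    have "\<forall>\<^sub>F h in at_right 0. dist ((1 - g h) / complex_of_real h) \<psi> < e" using lim e by (rule tendstoD)
    moreover have "\<forall>\<^sub>F h in at_right 0. h > (0::real)" by (rule eventually_at_right_less)
    ultimately show "\<forall>\<^sub>F h in at_right 0. \<forall>r\<in>{0..}. dist ((g (r + h) - g r) / complex_of_real h) (- \<psi> * g r) < e"
    proof eventually_elim
      fix h r :: real assume h: "dist ((1 - g h) / complex_of_real h) \<psi> < e" "h > 0"
      show "\<forall>r\<in>{0..}. dist ((g (r + h) - g r) / complex_of_real h) (- \<psi> * g r) < e"
      proof
        fix r :: real assume r: "r \<in> {0..}"
        have "(g (r + h) - g r) / complex_of_real h - - \<psi> * g r = - g r * ((1 - g h) / complex_of_real h - \<psi>)"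
          using mult[of r h] r h by (simp add: field_simps)
        then have "dist ((g (r + h) - g r) / complex_of_real h) (- \<psi> * g r)
            = cmod (g r) * dist ((1 - g h) / complex_of_real h) \<psi>"
          by (simp add: dist_norm norm_mult)
        also have "\<dots> \<le> 1 * dist ((1 - g h) / complex_of_real h) \<psi>"
          using bdd r by (intro mult_right_mono) auto
        finally show "dist ((g (r + h) - g r) / complex_of_real h) (- \<psi> * g r) < e" using h by simp
      qed
    qed
  qed
  then have hi: "((\<lambda>r. - \<psi> * g r) has_integral (g t - g 0)) {0..t}" if "0 \<le> t" for t
    using that bdd
    by (intro uniform_forward_difference_quotient_integral(2)[where C="cmod \<psi>"])
      (auto simp: norm_mult intro!: mult_left_le)
  have int: "set_integrable lborel {0..t} g" for t
    by (intro borel_integrable_atLeastAtMost' gc) auto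
  have "g t = g 0 - \<psi> * (LBINT q:{0..t}. g q)" if "0 \<le> t" for t
  proof -
    have "integral {0..t} (\<lambda>r. - \<psi> * g r) = g t - g 0" using hi[OF that] by (rule integral_unique)
    then show ?thesis
      by (simp add: set_borel_integral_eq_integral(2)[OF int] algebra_simps)
  qed
  then have "g t = exp (- (complex_of_real t * \<psi>))" if "0 \<le> t" for t
    using linear_integral_equation_unique[OF that int, of \<psi>] g0 by simp
  then show thesis using lim that by blast
qed

section \<open>Restricted laws, kernels and injectivity of the transform\<close>

text \<open>A density is used instead of passing to a subspace, so the space and the
  \<sigma>-algebra stay those of \<open>M\<close> and measurability of functions is
  unaffected.\<close>

definition restricted_measure :: "'a measure \<Rightarrow> 'a set \<Rightarrow> 'a measure" where
  "restricted_measure M A = density M (\<lambda>x. ennreal (indicator A x))"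

lemma sets_restricted_measure[simp, measurable_cong]: "sets (restricted_measure M A) = sets M"
  and space_restricted_measure[simp]: "space (restricted_measure M A) = space M"
  by (simp_all add: restricted_measure_def)

lemma integral_restricted_measure:
  fixes f :: "'a \<Rightarrow> 'b::{banach, second_countable_topology}"
  assumes "A \<in> sets M" "f \<in> borel_measurable M"
  shows "integral\<^sup>L (restricted_measure M A) f = (LINT x:A|M. f x)"
  using assms unfolding restricted_measure_def set_lebesgue_integral_def by (intro integral_density) auto

lemma integrable_restricted_measure:
  fixes f :: "'a \<Rightarrow> 'b::{banach, second_countable_topology}"
  assumes "A \<in> sets M" "f \<in> borel_measurable M"
  shows "integrable (restricted_measure M A) f \<longleftrightarrow> set_integrable M A f"
  using assms unfolding restricted_measure_def set_integrable_def by (intro integrable_density) auto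

lemma emeasure_restricted_measure:
  assumes "A \<in> sets M" "B \<in> sets M"
  shows "emeasure (restricted_measure M A) B = emeasure M (A \<inter> B)"
  using assms unfolding restricted_measure_def by (simp add: emeasure_density ennreal_indicator indicator_inter_arith[symmetric])

lemma finite_measure_restricted_measure:
  assumes "A \<in> sets M" "emeasure M A < \<infinity>"
  shows "finite_measure (restricted_measure M A)"
proof (rule finite_measureI)
  have "emeasure (restricted_measure M A) (space M) \<le> emeasure M A"
    using assms(1) by (simp add: emeasure_restricted_measure emeasure_mono)
  then show "emeasure (restricted_measure M A) (space (restricted_measure M A)) \<noteq> \<infinity>" using assms(2) by auto
qed

lemma (in finite_measure) integrable_bounded:
  fixes f :: "'a \<Rightarrow> complex"
  assumes "f \<in> borel_measurable M" "\<And>x. cmod (f x) \<le> B"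
  shows "integrable M f"
  using assms by (intro integrable_const_bound[where B=B]) auto

lemma (in finite_measure) norm_integral_le_measure:
  fixes f :: "'a \<Rightarrow> complex"
  assumes "f \<in> borel_measurable M" "\<And>x. cmod (f x) \<le> B"
  shows "cmod (integral\<^sup>L M f) \<le> B * measure M (space M)"
proof -
  have "cmod (integral\<^sup>L M f) \<le> (\<integral>x. cmod (f x) \<partial>M)" by (rule integral_norm_bound)
  also have "\<dots> \<le> (\<integral>x. B \<partial>M)"
    using integrable_bounded[OF assms] assms(2) by (intro integral_mono) auto
  finally have "cmod (integral\<^sup>L M f) \<le> (\<integral>x. B \<partial>M)" .
  then show ?thesis by (simp add: mult.commute)
qed

lemma (in finite_measure_subalgebra) real_cond_exp_AE_eq_iff:
  assumes f: "integrable M f" and g: "integrable M g" "g \<in> borel_measurable F"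
  shows "(AE \<omega> in M. real_cond_exp M F f \<omega> = g \<omega>) \<longleftrightarrow>
    (\<forall>A\<in>sets F. (LINT x:A|M. f x) = (LINT x:A|M. g x))"
proof
  assume ae: "AE \<omega> in M. real_cond_exp M F f \<omega> = g \<omega>"
  show "\<forall>A\<in>sets F. (LINT x:A|M. f x) = (LINT x:A|M. g x)"
  proof
    fix A assume A: "A \<in> sets F"
    then have [measurable]: "A \<in> sets M" using subalg by (auto simp: subalgebra_def)
    note [measurable] = borel_measurable_integrable[OF g(1)]
    have "(LINT x:A|M. f x) = (LINT x:A|M. real_cond_exp M F f x)"
      by (rule real_cond_exp_intA[OF f A])
    also have "\<dots> = (LINT x:A|M. g x)"
      unfolding set_lebesgue_integral_def
      using ae by (intro integral_cong_AE) (auto elim!: eventually_mono)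
    finally show "(LINT x:A|M. f x) = (LINT x:A|M. g x)" .
  qed
qed (use real_cond_exp_charact[OF _ f g] in blast)

lemma (in finite_measure_subalgebra) complex_cond_exp_AE_eq_iff:
  assumes f: "integrable M f" and g: "integrable M g" "g \<in> borel_measurable F"
  shows "(AE \<omega> in M. complex_cond_exp M F f \<omega> = g \<omega>) \<longleftrightarrow>
    (\<forall>A\<in>sets F. (LINT x:A|M. f x) = (LINT x:A|M. g x))"
proof -
  have ReIm: "Re (LINT x:A|M. h x) = (LINT x:A|M. Re (h x))" "Im (LINT x:A|M. h x) = (LINT x:A|M. Im (h x))"
    if "A \<in> sets F" "integrable M h" for A and h :: "'a \<Rightarrow> complex"
  proof -
    have "A \<in> sets M" using that subalg by (auto simp: subalgebra_def)
    then have "integrable M (\<lambda>x. indicator A x *\<^sub>R h x)"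
      using that(2) by (rule integrable_mult_indicator)
    then show "Re (LINT x:A|M. h x) = (LINT x:A|M. Re (h x))" "Im (LINT x:A|M. h x) = (LINT x:A|M. Im (h x))"
      unfolding set_lebesgue_integral_def by (simp_all flip: integral_Re integral_Im)
  qed
  have "(AE \<omega> in M. complex_cond_exp M F f \<omega> = g \<omega>) \<longleftrightarrow>
      (AE \<omega> in M. real_cond_exp M F (\<lambda>x. Re (f x)) \<omega> = Re (g \<omega>)) \<and>
      (AE \<omega> in M. real_cond_exp M F (\<lambda>x. Im (f x)) \<omega> = Im (g \<omega>))"
    by (simp add: complex_cond_exp_def complex_eq_iff)
  also have "\<dots> \<longleftrightarrow> (\<forall>A\<in>sets F. (LINT x:A|M. Re (f x)) = (LINT x:A|M. Re (g x))) \<and>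
      (\<forall>A\<in>sets F. (LINT x:A|M. Im (f x)) = (LINT x:A|M. Im (g x)))"
    using f g by (intro arg_cong2[where f="(\<and>)"] real_cond_exp_AE_eq_iff) auto
  also have "\<dots> \<longleftrightarrow> (\<forall>A\<in>sets F. (LINT x:A|M. f x) = (LINT x:A|M. g x))"
    using f g(1) by (auto simp: complex_eq_iff ReIm)
  finally show ?thesis .
qed

lemma martingale_iff_set_integrals:
  assumes "prob_space M"
    and sub: "\<And>t. 0 \<le> t \<Longrightarrow> subalgebra M (F t)"
    and Y: "\<And>t. 0 \<le> t \<Longrightarrow> Y t \<in> borel_measurable (F t)" "\<And>t. 0 \<le> t \<Longrightarrow> integrable M (Y t)"
  shows "martingale M F Y \<longleftrightarrow>
    (\<forall>s\<ge>0. \<forall>t\<ge>s. \<forall>A\<in>sets (F s). (LINT \<omega>:A|M. Y t \<omega>) = (LINT \<omega>:A|M. Y s \<omega>))"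
proof -
  interpret prob_space M by fact
  have "(AE \<omega> in M. complex_cond_exp M (F s) (Y t) \<omega> = Y s \<omega>) \<longleftrightarrow>
    (\<forall>A\<in>sets (F s). (LINT \<omega>:A|M. Y t \<omega>) = (LINT \<omega>:A|M. Y s \<omega>))" if "0 \<le> s" "s \<le> t" for s t
  proof -
    interpret finite_measure_subalgebra M "F s"
      using sub[OF that(1)] by unfold_locales
    show ?thesis using that Y by (intro complex_cond_exp_AE_eq_iff) auto
  qed
  then show ?thesis using Y by (simp add: martingale_def)
qed

text \<open>For a probability measure \<open>M\<close> the total mass is the probability of
  \<open>A\<close>. Leaving it unnormalised admits null events and makes integrals against it the
  integrals over \<open>A\<close> themselves.\<close>

definition restricted_law :: "'w measure \<Rightarrow> 'w set \<Rightarrow> ('w \<Rightarrow> 'x::topological_space) \<Rightarrow> 'x measure" where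
  "restricted_law M A Y = distr (restricted_measure M A) borel Y"

lemma sets_restricted_law[simp, measurable_cong]: "sets (restricted_law M A Y) = sets borel"
  and space_restricted_law[simp]: "space (restricted_law M A Y) = UNIV"
  by (simp_all add: restricted_law_def)

lemma integral_restricted_law:
  fixes f :: "'x::topological_space \<Rightarrow> 'b::{banach, second_countable_topology}"
  assumes A: "A \<in> sets M" and [measurable]: "Y \<in> borel_measurable M" "f \<in> borel_measurable borel"
  shows "integral\<^sup>L (restricted_law M A Y) f = (LINT \<omega>:A|M. f (Y \<omega>))"
proof -
  have "integral\<^sup>L (restricted_law M A Y) f = (\<integral>\<omega>. f (Y \<omega>) \<partial>restricted_measure M A)"
    unfolding restricted_law_def by (intro integral_distr) measurable
  then show ?thesis using integral_restricted_measure[OF A, of "\<lambda>\<omega>. f (Y \<omega>)"] by simp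
qed

lemma subprob_space_restricted_law:
  assumes "prob_space M" and A: "A \<in> sets M" and [measurable]: "Y \<in> borel_measurable M"
  shows "subprob_space (restricted_law M A Y)"
  unfolding restricted_law_def
proof (rule subprob_space.subprob_space_distr)
  interpret prob_space M by fact
  show "subprob_space (restricted_measure M A)"
    using A by (intro subprob_spaceI) (simp_all add: emeasure_restricted_measure not_empty emeasure_le_1)
  show "Y \<in> restricted_measure M A \<rightarrow>\<^sub>M borel" by measurable
qed simp

section \<open>Markov kernels and integration against their compositions\<close>

lemma kernel_integral_measurable:
  fixes f :: "'x::topological_space \<Rightarrow> complex"
  assumes "markov_kernel K" "f \<in> borel_measurable borel"
  shows "(\<lambda>x. integral\<^sup>L (K x) f) \<in> borel_measurable borel"
  using measurable_compose[OF measurable_prob_algebraD integral_measurable_subprob_algebra] assms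
  unfolding markov_kernel_def by blast

lemma markov_kernelD:
  assumes "markov_kernel K"
  shows "prob_space (K x)" "sets (K x) = sets borel" "space (K x) = UNIV"
proof -
  have "K x \<in> space (prob_algebra borel)"
    using assms by (auto simp: markov_kernel_def intro: measurable_space)
  then show "prob_space (K x)" "sets (K x) = sets borel" by (auto simp: space_prob_algebra)
  then show "space (K x) = UNIV" by (metis sets_eq_imp_space_eq space_borel)
qed

lemma kernel_integral_norm_le:
  fixes f :: "'x::topological_space \<Rightarrow> complex"
  assumes K: "markov_kernel K" and f: "f \<in> borel_measurable borel" "\<And>x. cmod (f x) \<le> B"
  shows "cmod (integral\<^sup>L (K x) f) \<le> B"
proof -
  interpret prob_space "K x" using K by (rule markov_kernelD)
  have "f \<in> borel_measurable (K x)" using f(1) by (simp cong: measurable_cong_sets add: markov_kernelD[OF K])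
  from norm_integral_le_measure[OF this f(2)] show ?thesis by (simp add: prob_space)
qed

lemma integral_bind_markov_kernel_real:
  fixes f :: "'x::topological_space \<Rightarrow> real"
  assumes \<mu>: "finite_measure \<mu>" "sets \<mu> = sets borel" and K: "markov_kernel K"
    and f: "f \<in> borel_measurable borel" "\<And>x. \<bar>f x\<bar> \<le> B"
  shows "integral\<^sup>L (\<mu> \<bind> K) f = (\<integral>x. integral\<^sup>L (K x) f \<partial>\<mu>)"
proof (rule integral_bind[where K=borel and B'=1, OF f(1,2) _ \<mu>(1)])
  show "K \<in> \<mu> \<rightarrow>\<^sub>M subprob_algebra borel"
    using K measurable_prob_algebraD unfolding markov_kernel_def
    by (simp cong: measurable_cong_sets add: \<mu>(2)) blast
  show "AE x in \<mu>. emeasure (K x) (space (K x)) \<le> ennreal 1"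
    using prob_space.emeasure_space_1[OF markov_kernelD(1)[OF K]] by simp
qed

lemma sets_bind_markov_kernel:
  assumes "sets \<mu> = sets borel" and K: "markov_kernel K"
  shows "sets (\<mu> \<bind> K) = sets (borel :: 'x::topological_space measure)"
proof (rule sets_bind)
  show "space \<mu> \<noteq> {}" using assms(1) by (metis UNIV_not_empty sets_eq_imp_space_eq space_borel)
qed (rule markov_kernelD[OF K])

lemma subprob_bind_markov_kernel:
  assumes "subprob_space \<mu>" "sets \<mu> = sets borel" and K: "markov_kernel K"
  shows "subprob_space (\<mu> \<bind> K)"
proof (rule subprob_space_bind[OF assms(1)])
  show "K \<in> \<mu> \<rightarrow>\<^sub>M subprob_algebra borel"
    using K measurable_prob_algebraD unfolding markov_kernel_def
    by (simp cong: measurable_cong_sets add: assms(2)) blast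
qed

text \<open>The real identity is applied to \<open>Re\<close> and \<open>Im\<close>; the bound on
  \<open>f\<close> supplies the integrability that lets both commute with the three kinds of
  integral involved. Subprobability measures are the fitting class, since restricted laws are of
  this kind.\<close>

lemma integral_bind_markov_kernel:
  fixes f :: "'x::topological_space \<Rightarrow> complex"
  assumes \<mu>: "subprob_space \<mu>" "sets \<mu> = sets borel" and K: "markov_kernel K"
    and f: "f \<in> borel_measurable borel" "\<And>x. cmod (f x) \<le> B"
  shows "integral\<^sup>L (\<mu> \<bind> K) f = (\<integral>x. integral\<^sup>L (K x) f \<partial>\<mu>)"
proof -
  interpret m: subprob_space \<mu> by fact
  interpret b: subprob_space "\<mu> \<bind> K" using \<mu> K by (rule subprob_bind_markov_kernel)
  have mb: "borel_measurable (\<mu> \<bind> K) = borel_measurable borel" "borel_measurable \<mu> = borel_measurable borel"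
    "borel_measurable (K x) = borel_measurable borel" for x
    by (simp_all cong: measurable_cong_sets add: sets_bind_markov_kernel \<mu> K markov_kernelD[OF K])
  have ib: "integrable (\<mu> \<bind> K) f" using f by (intro b.integrable_bounded) (simp_all add: mb)
  have iK: "integrable (K x) f" for x
  proof -
    interpret prob_space "K x" using K by (rule markov_kernelD)
    show ?thesis using f by (intro integrable_bounded) (simp_all add: mb)
  qed
  have im: "integrable \<mu> (\<lambda>x. integral\<^sup>L (K x) f)"
    using kernel_integral_measurable[OF K f(1)] kernel_integral_norm_le[OF K f]
    by (intro m.integrable_bounded) (simp_all add: mb)
  have "(\<integral>x. Re (f x) \<partial>(\<mu> \<bind> K)) = (\<integral>x. (\<integral>y. Re (f y) \<partial>K x) \<partial>\<mu>)"
    using f order_trans[OF abs_Re_le_cmod f(2)]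
    by (intro integral_bind_markov_kernel_real m.finite_measure_axioms \<mu> K) auto
  moreover have "(\<integral>x. Im (f x) \<partial>(\<mu> \<bind> K)) = (\<integral>x. (\<integral>y. Im (f y) \<partial>K x) \<partial>\<mu>)"
    using f order_trans[OF abs_Im_le_cmod f(2)]
    by (intro integral_bind_markov_kernel_real m.finite_measure_axioms \<mu> K) auto
  ultimately show ?thesis
    using ib iK im by (simp add: complex_eq_iff)
qed

section \<open>The transform of finite measures: joint continuity, duality and injectivity\<close>

lemma C0_bounded:
  assumes "g \<in> C0" shows "\<exists>B. \<forall>x. cmod (g x) \<le> B"
proof -
  have g: "continuous_on UNIV g" using assms by (simp add: C0_def)
  obtain K where K: "compact K" "\<And>x. x \<notin> K \<Longrightarrow> cmod (g x) < 1"
    using assms zero_less_one unfolding C0_def by blast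
  have "bounded (g ` K)"
    using K(1) g by (intro compact_imp_bounded compact_continuous_image) (auto intro: continuous_on_subset)
  then obtain B where B: "\<forall>x\<in>K. cmod (g x) \<le> B" by (auto simp: bounded_iff)
  have "cmod (g x) \<le> max B 1" for x
    using B K(2)[of x] by (cases "x \<in> K") (auto intro: order_trans less_imp_le)
  then show ?thesis by blast
qed

text \<open>On a compact neighbourhood of the point in X, \<open>\<phi> \<xi>\<close> is uniformly
  close to the limit function, which is itself continuous; each of the two errors is below
  \<open>e/2\<close>. Joint continuity is wanted for the joint measurability in Fubini.\<close>

lemma abstract_integral_transform_continuous_pair:
  assumes "abstract_integral_transform \<phi>"
  shows "continuous_on UNIV (\<lambda>(\<xi>, x). \<phi> \<xi> x)"
proof -
  have lc: "locally_compact_space (euclidean :: 'b topology)"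
    and cont: "\<And>\<xi>. continuous_on UNIV (\<phi> \<xi>)"
    and ul: "\<And>\<xi>\<^sub>0 K. compact K \<Longrightarrow> uniform_limit K \<phi> (\<phi> \<xi>\<^sub>0) (nhds \<xi>\<^sub>0)"
    using assms by (auto simp: abstract_integral_transform_def Cb_def)
  have "isCont (\<lambda>(\<xi>, x). \<phi> \<xi> x) (\<xi>\<^sub>0, x\<^sub>0)" for \<xi>\<^sub>0 x\<^sub>0
    unfolding isCont_def
  proof (rule tendstoI)
    fix e :: real assume e: "e > 0"
    obtain V where V: "open V" "x\<^sub>0 \<in> V" "compact (closure V)"
      using locally_compact_t2_open_nbhd[OF lc open_UNIV UNIV_I] by metis
    have "\<forall>\<^sub>F \<xi> in nhds \<xi>\<^sub>0. \<forall>x\<in>closure V. dist (\<phi> \<xi> x) (\<phi> \<xi>\<^sub>0 x) < e/2"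
      using ul[OF V(3)] e by (intro uniform_limitD) auto
    then obtain U where U: "open U" "\<xi>\<^sub>0 \<in> U"
      "\<And>\<xi> x. \<xi> \<in> U \<Longrightarrow> x \<in> closure V \<Longrightarrow> dist (\<phi> \<xi> x) (\<phi> \<xi>\<^sub>0 x) < e/2"
      by (auto simp: eventually_nhds)
    have "isCont (\<phi> \<xi>\<^sub>0) x\<^sub>0" using cont[of \<xi>\<^sub>0] by (simp add: continuous_on_eq_continuous_at)
    then have "\<forall>\<^sub>F x in nhds x\<^sub>0. dist (\<phi> \<xi>\<^sub>0 x) (\<phi> \<xi>\<^sub>0 x\<^sub>0) < e/2"
      using e unfolding isCont_def tendsto_at_iff_tendsto_nhds by (intro tendstoD) auto
    then obtain W where W: "open W" "x\<^sub>0 \<in> W" "\<And>x. x \<in> W \<Longrightarrow> dist (\<phi> \<xi>\<^sub>0 x) (\<phi> \<xi>\<^sub>0 x\<^sub>0) < e/2"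
      by (auto simp: eventually_nhds)
    have "dist (\<phi> \<xi> x) (\<phi> \<xi>\<^sub>0 x\<^sub>0) < e" if "\<xi> \<in> U" "x \<in> V \<inter> W" for \<xi> x
      using U(3)[of \<xi> x] W(3)[of x] that closure_subset[of V]
        dist_triangle[of "\<phi> \<xi> x" "\<phi> \<xi>\<^sub>0 x\<^sub>0" "\<phi> \<xi>\<^sub>0 x"] by fastforce
    then show "\<forall>\<^sub>F p in at (\<xi>\<^sub>0, x\<^sub>0). dist (case p of (\<xi>, x) \<Rightarrow> \<phi> \<xi> x) (case (\<xi>\<^sub>0, x\<^sub>0) of (\<xi>, x) \<Rightarrow> \<phi> \<xi> x) < e"
      unfolding eventually_at_topological using U V W
      by (intro exI[of _ "U \<times> (V \<inter> W)"]) (auto intro: open_Times)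
  qed
  then show ?thesis by (auto simp: continuous_on_eq_continuous_at)
qed

text \<open>Fubini for the kernel \<open>\<phi>\<close> gives this duality, a form of Parseval's
  identity. It shows that finite measures with equal transforms integrate every inverse transform
  alike.\<close>

lemma integral_inverse_transform:
  fixes \<phi> :: "'l::t2_space \<Rightarrow> 'x::{second_countable_topology, t2_space} \<Rightarrow> complex"
  assumes T: "abstract_integral_transform \<phi>" and \<pi>: "sets \<pi> = sets borel" and f: "integrable \<pi> f"
    and \<mu>: "finite_measure \<mu>" "sets \<mu> = sets borel"
  shows "(\<integral>x. inverse_transform \<phi> \<pi> f x \<partial>\<mu>) = (\<integral>\<xi>. f \<xi> * transform \<phi> \<mu> \<xi> \<partial>\<pi>)"
proof -
  have bdd: "\<And>\<xi> x. cmod (\<phi> \<xi> x) \<le> 1"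
    using T by (auto simp: abstract_integral_transform_def)
  have [measurable_cong]: "sets \<pi> = sets borel" "sets \<mu> = sets borel" by fact+
  have [measurable]: "(\<lambda>(\<xi>, x). \<phi> \<xi> x) \<in> borel_measurable (borel \<Otimes>\<^sub>M borel)"
    by (rule borel_measurable_pair_continuous[OF abstract_integral_transform_continuous_pair[OF T]])
  have [measurable]: "f \<in> borel_measurable borel"
    using borel_measurable_integrable[OF f] by (simp cong: measurable_cong_sets add: \<pi>)
  \<comment> \<open>\<open>\<pi>\<close> need not be \<open>\<sigma>\<close>-finite, so Fubini is applied to the finite measure with density \<open>\<bar>f\<bar>\<close>.\<close>
  define \<rho> where "\<rho> = density \<pi> (\<lambda>\<xi>. ennreal (cmod (f \<xi>)))"
  \<comment> \<open>\<open>h\<close> is the phase of \<open>f\<close>; division by zero yields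
    \<open>h = 0\<close> where \<open>f\<close> vanishes, so \<open>f\<close> is its modulus times
    \<open>h\<close> everywhere and \<open>h\<close> is bounded by 1.\<close>
  define h where "h \<xi> = f \<xi> /\<^sub>R cmod (f \<xi>)" for \<xi>
  have [measurable_cong]: "sets \<rho> = sets borel" by (simp add: \<rho>_def \<pi>)
  have [measurable]: "h \<in> borel_measurable borel" unfolding h_def by measurable
  have h1: "cmod (h \<xi>) \<le> 1" for \<xi> by (cases "f \<xi> = 0") (simp_all add: h_def)
  have fh: "cmod (f \<xi>) *\<^sub>R (h \<xi> * z) = f \<xi> * z" for \<xi> z 
    by (cases "f \<xi> = 0") (simp_all add: h_def)
  interpret mu: finite_measure \<mu> by fact
  interpret rho: finite_measure \<rho>
  proof (rule finite_measureI)
    have "emeasure \<rho> (space \<rho>) = (\<integral>\<^sup>+\<xi>. ennreal (cmod (f \<xi>)) \<partial>\<pi>)"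
      unfolding \<rho>_def by (subst emeasure_density) (auto intro!: nn_integral_cong)
    also have "\<dots> < \<infinity>" using f by (simp add: integrable_iff_bounded)
    finally show "emeasure \<rho> (space \<rho>) \<noteq> \<infinity>" by simp
  qed
  interpret pair: pair_sigma_finite \<rho> \<mu> ..
  interpret prod: finite_measure "\<rho> \<Otimes>\<^sub>M \<mu>"
    by (rule finite_measure_pair_measure[OF mu.finite_measure_axioms rho.finite_measure_axioms])
  have sub: "(\<integral>\<xi>. h \<xi> * k \<xi> \<partial>\<rho>) = (\<integral>\<xi>. f \<xi> * k \<xi> \<partial>\<pi>)"
    if [measurable]: "k \<in> borel_measurable borel" for k
    unfolding \<rho>_def by (subst integral_density) (auto simp: fh)
  have "integrable (\<rho> \<Otimes>\<^sub>M \<mu>) (\<lambda>(\<xi>, x). h \<xi> * \<phi> \<xi> x)"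
  proof (rule prod.integrable_bounded)
    fix p show "cmod (case p of (\<xi>, x) \<Rightarrow> h \<xi> * \<phi> \<xi> x) \<le> 1"
      using mult_mono[OF h1 bdd] by (auto simp: norm_mult split: prod.splits)
  qed measurable
  then have "(\<integral>x. (\<integral>\<xi>. h \<xi> * \<phi> \<xi> x \<partial>\<rho>) \<partial>\<mu>) = (\<integral>\<xi>. (\<integral>x. h \<xi> * \<phi> \<xi> x \<partial>\<mu>) \<partial>\<rho>)"
    by (rule pair.Fubini_integral)
  also have "\<dots> = (\<integral>\<xi>. h \<xi> * (\<integral>x. \<phi> \<xi> x \<partial>\<mu>) \<partial>\<rho>)" by simp
  also have "\<dots> = (\<integral>\<xi>. f \<xi> * (\<integral>x. \<phi> \<xi> x \<partial>\<mu>) \<partial>\<pi>)" by (rule sub) measurable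
  finally show ?thesis by (simp add: sub inverse_transform_def transform_def)
qed

lemma transform_injective:
  fixes \<phi> :: "'l::t2_space \<Rightarrow> 'x::{second_countable_topology, t2_space} \<Rightarrow> complex"
  assumes T: "abstract_integral_transform \<phi>"
    and fin: "finite_measure \<mu>" "finite_measure \<nu>"
    and sets: "sets \<mu> = sets borel" "sets \<nu> = sets borel"
    and eq: "\<And>\<xi>. transform \<phi> \<mu> \<xi> = transform \<phi> \<nu> \<xi>"
  shows "\<mu> = \<nu>"
proof (rule finite_measure_eqI_C0[OF _ fin sets])
  show "locally_compact_space (euclidean :: 'x topology)"
    using T by (simp add: abstract_integral_transform_def)
  obtain \<pi> where \<pi>: "sets \<pi> = sets borel"
    and C0: "\<And>f. integrable \<pi> f \<Longrightarrow> inverse_transform \<phi> \<pi> f \<in> C0"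
    and dense: "\<And>g \<epsilon>. g \<in> C0 \<Longrightarrow> \<epsilon> > 0 \<Longrightarrow>
      \<exists>f. integrable \<pi> f \<and> (\<forall>x. cmod (inverse_transform \<phi> \<pi> f x - g x) \<le> \<epsilon>)"
    using T unfolding abstract_integral_transform_def radon_measure_def by (elim conjE exE) simp
  fix g :: "'x \<Rightarrow> complex" assume g: "g \<in> C0"
  have meas: "h \<in> borel_measurable \<kappa>" if "h \<in> C0" "sets \<kappa> = sets borel" for h and \<kappa> :: "'x measure"
    using that borel_measurable_continuous_onI[of h] by (simp cong: measurable_cong_sets add: C0_def)
  have int: "integrable \<kappa> h" if "h \<in> C0" "sets \<kappa> = sets borel" "finite_measure \<kappa>" for h and \<kappa> :: "'x measure"
    using C0_bounded[OF that(1)] meas[OF that(1,2)] finite_measure.integrable_bounded[OF that(3)] by blast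
  \<comment> \<open>A uniform error \<open>e / (c + 1)\<close> costs at most
    \<open>e * (c / (c + 1)) \<le> e\<close> when integrated against both measures; the added 1
    avoids division by zero when both measures vanish.\<close>
  define c where "c = measure \<mu> (space \<mu>) + measure \<nu> (space \<nu>)"
  have c: "c \<ge> 0" by (simp add: c_def)
  have "cmod (integral\<^sup>L \<mu> g - integral\<^sup>L \<nu> g) \<le> 0 + e" if e: "e > 0" for e
  proof -
    have "e / (c + 1) > 0" using e c by simp
    from dense[OF g this] obtain f where f: "integrable \<pi> f"
      "\<And>x. cmod (inverse_transform \<phi> \<pi> f x - g x) \<le> e / (c + 1)" by blast
    define F where "F = inverse_transform \<phi> \<pi> f"
    have F: "F \<in> C0" using C0[OF f(1)] by (simp add: F_def)
    have close: "cmod (integral\<^sup>L \<kappa> F - integral\<^sup>L \<kappa> g) \<le> e / (c + 1) * measure \<kappa> (space \<kappa>)"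
      if "sets \<kappa> = sets borel" "finite_measure \<kappa>" for \<kappa>
    proof -
      have "integral\<^sup>L \<kappa> F - integral\<^sup>L \<kappa> g = (\<integral>x. F x - g x \<partial>\<kappa>)"
        using int[OF F that] int[OF g that] by simp
      also have "cmod \<dots> \<le> e / (c + 1) * measure \<kappa> (space \<kappa>)"
        using meas[OF F that(1)] meas[OF g that(1)] f(2)
        by (intro finite_measure.norm_integral_le_measure[OF that(2)]) (auto simp: F_def)
      finally show ?thesis .
    qed
    have "integral\<^sup>L \<mu> F = integral\<^sup>L \<nu> F"
      unfolding F_def by (simp add: integral_inverse_transform[OF T \<pi> f(1)] fin sets eq)
    then have "integral\<^sup>L \<mu> g - integral\<^sup>L \<nu> g = (integral\<^sup>L \<nu> F - integral\<^sup>L \<nu> g) - (integral\<^sup>L \<mu> F - integral\<^sup>L \<mu> g)"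
      by simp
    also have "cmod \<dots> \<le> e / (c + 1) * measure \<nu> (space \<nu>) + e / (c + 1) * measure \<mu> (space \<mu>)"
      by (intro order_trans[OF norm_triangle_ineq4] add_mono close sets fin)
    also have "\<dots> = e * (c / (c + 1))" by (simp add: c_def add_divide_distrib distrib_left)
    also have "\<dots> \<le> e" using e c by (intro mult_left_le) auto
    finally show ?thesis by simp
  qed
  then have "cmod (integral\<^sup>L \<mu> g - integral\<^sup>L \<nu> g) \<le> 0" by (rule field_le_epsilon)
  then show "integral\<^sup>L \<mu> g = integral\<^sup>L \<nu> g" by simp
qed

section \<open>Generators and martingales of path integrals\<close>

lemma subalgebra_canonical_filtration:
  assumes "cadlag_process M X"
  shows "subalgebra M (canonical_filtration M X t)"
proof -
  have "{X u -` B \<inter> space M | u B. 0 \<le> u \<and> u \<le> t \<and> B \<in> sets borel} \<subseteq> sets M"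
    using assms by (auto simp: cadlag_process_def intro: measurable_sets)
  note G = this sets.sigma_sets_subset[OF this] order_trans[OF this sets.space_closed]
  show ?thesis
    unfolding subalgebra_def canonical_filtration_def
    using G(2) by (simp add: sets_measure_of[OF G(3)] space_measure_of_conv)
qed

lemma measurable_canonical_filtration:
  assumes "0 \<le> u" "u \<le> t"
  shows "X u \<in> borel_measurable (canonical_filtration M X t)"
proof (rule measurableI)
  fix B :: "'b set" assume "B \<in> sets borel"
  then show "X u -` B \<inter> space (canonical_filtration M X t) \<in> sets (canonical_filtration M X t)"
    using assms unfolding canonical_filtration_def
    by (subst sets_measure_of) (auto simp: space_measure_of_conv intro!: sigma_sets.Basic)
qed simp

lemma sets_canonical_filtration_mono:
  assumes "s \<le> t"
  shows "sets (canonical_filtration M X s) \<subseteq> sets (canonical_filtration M X t)"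
proof -
  have "{X u -` B \<inter> space M | u B. 0 \<le> u \<and> u \<le> s \<and> B \<in> sets borel}
      \<subseteq> {X u -` B \<inter> space M | u B. 0 \<le> u \<and> u \<le> t \<and> B \<in> sets borel}"
    using assms by (force intro: order_trans)
  then show ?thesis
    unfolding canonical_filtration_def
    by (subst (1 2) sets_measure_of) (auto intro!: sigma_sets_mono')
qed

text \<open>\<open>generator\<close> is a pointwise \<open>Lim\<close>, meaningful only where the
  limit exists; the uniform limit promised by the domain identifies it. Boundedness is inherited
  from the single quotient at time \<open>b/2\<close>, which is within distance 1, and measurability
  from the quotients at the times \<open>1/(n+1)\<close>. The last bound may blow up as
  \<open>t\<close> decreases to 0; it serves integrability at each fixed time.\<close>

lemma bounded_generator_domain_generator:
  assumes f: "f \<in> bounded_generator_domain P"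
    and kernels: "\<forall>t\<ge>0. markov_kernel (P t)"
  shows "uniform_limit UNIV (diff_quotient P f) (generator P f) (at_right 0)"
    and "generator P f \<in> borel_measurable borel"
    and "\<exists>C. \<forall>x. cmod (generator P f x) \<le> C"
    and "f \<in> borel_measurable borel"
    and "\<exists>B. \<forall>x. cmod (f x) \<le> B"
    and "\<And>t. 0 \<le> t \<Longrightarrow> diff_quotient P f t \<in> borel_measurable borel"
    and "\<exists>B. \<forall>t>0. \<forall>x. cmod (diff_quotient P f t x) \<le> B / t"
proof -
  note K = kernels[rule_format]
  obtain g where g: "uniform_limit UNIV (diff_quotient P f) g (at_right 0)" and fc: "continuous_on UNIV f"
    using f by (auto simp: bounded_generator_domain_def generator_domain_def)
  have "generator P f = g"
  proof
    fix x
    have "((\<lambda>t. diff_quotient P f t x) \<longlongrightarrow> g x) (at_right 0)"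
      using tendsto_uniform_limitI[OF g] by simp
    then show "generator P f x = g x"
      unfolding generator_def by (intro tendsto_Lim trivial_limit_at_right_real)
  qed
  then show ul: "uniform_limit UNIV (diff_quotient P f) (generator P f) (at_right 0)" using g by simp
  show fm: "f \<in> borel_measurable borel" using fc by (rule borel_measurable_continuous_onI)
  show fb: "\<exists>B. \<forall>x. cmod (f x) \<le> B"
    using f by (auto simp: bounded_generator_domain_def Cb_def bounded_iff)
  then obtain B where B: "\<And>x. cmod (f x) \<le> B" by blast
  show dm: "diff_quotient P f t \<in> borel_measurable borel" if "0 \<le> t" for t
    using kernel_integral_measurable[OF K[OF that] fm] fm
    unfolding diff_quotient_def kernel_op_def by measurable
  have db: "cmod (diff_quotient P f t x) \<le> 2 * B / t" if "t > 0" for t x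
  proof -
    have "cmod ((\<integral>y. f y \<partial>P t x) - f x) \<le> B + B"
      using that by (intro order_trans[OF norm_triangle_ineq4] add_mono kernel_integral_norm_le K fm B) auto
    then show ?thesis
      using that unfolding diff_quotient_def kernel_op_def
      by (simp add: norm_divide divide_right_mono)
  qed
  then show "\<exists>B. \<forall>t>0. \<forall>x. cmod (diff_quotient P f t x) \<le> B / t" by blast
  show "\<exists>C. \<forall>x. cmod (generator P f x) \<le> C"
  proof -
    have "\<forall>\<^sub>F t in at_right 0. \<forall>x\<in>UNIV. dist (diff_quotient P f t x) (generator P f x) < 1"
      by (rule uniform_limitD[OF ul]) simp
    then obtain b where "b > 0" "\<And>t x. 0 < t \<Longrightarrow> t < b \<Longrightarrow> dist (diff_quotient P f t x) (generator P f x) < 1"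
      unfolding eventually_at_right_field by auto
    then have d: "dist (diff_quotient P f (b/2) x) (generator P f x) < 1" for x by simp
    have "cmod (generator P f x) \<le> 2 * B / (b/2) + 1" for x
    proof -
      have "cmod (generator P f x) \<le> cmod (diff_quotient P f (b/2) x) + dist (diff_quotient P f (b/2) x) (generator P f x)"
        unfolding dist_norm by (metis norm_triangle_sub norm_minus_commute)
      then show ?thesis using d[of x] db[of "b/2" x] \<open>b > 0\<close> by linarith
    qed
    then show ?thesis by blast
  qed
  show "generator P f \<in> borel_measurable borel"
  proof (rule borel_measurable_LIMSEQ_metric)
    fix x
    have "((\<lambda>t. diff_quotient P f t x) \<longlongrightarrow> generator P f x) (at_right 0)"
      using tendsto_uniform_limitI[OF ul] by simp
    moreover have "filterlim (\<lambda>n. inverse (real (Suc n))) (at_right 0) sequentially"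
      by (intro filterlim_at_withinI LIMSEQ_inverse_real_of_nat) auto
    ultimately show "(\<lambda>n. diff_quotient P f (inverse (real (Suc n))) x) \<longlonglongrightarrow> generator P f x"
      by (rule filterlim_compose)
  qed (intro dm, simp)
qed

text \<open>By the flow property the increment of \<open>\<integral> f d\<mu>_r\<close> over a step
  \<open>h\<close> is the integral of \<open>P_h f - f\<close> against \<open>\<mu>_r\<close>;
  masses at most 1 keep the convergence of the quotients uniform in \<open>r\<close>, and
  integrating the limit gives the formula. The flow is left abstract because it will consist of laws
  of later positions restricted to an event, with time starting afresh.\<close>

lemma Dynkin_formula:
  assumes f: "f \<in> bounded_generator_domain P"
    and kernels: "\<forall>t\<ge>0. markov_kernel (P t)"
    and \<mu>: "\<And>r. 0 \<le> r \<Longrightarrow> subprob_space (\<mu> r)" "\<And>r. 0 \<le> r \<Longrightarrow> sets (\<mu> r) = sets borel"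
    and \<mu>_add: "\<And>r h. 0 \<le> r \<Longrightarrow> 0 \<le> h \<Longrightarrow> \<mu> (r + h) = \<mu> r \<bind> P h"
  shows "continuous_on {0..} (\<lambda>r. integral\<^sup>L (\<mu> r) (generator P f))"
    and "0 \<le> t \<Longrightarrow> ((\<lambda>r. integral\<^sup>L (\<mu> r) (generator P f)) has_integral
      (integral\<^sup>L (\<mu> t) f - integral\<^sup>L (\<mu> 0) f)) {0..t}"
proof -
  note K = kernels[rule_format]
  define u where "u r = integral\<^sup>L (\<mu> r) f" for r
  define v where "v r = integral\<^sup>L (\<mu> r) (generator P f)" for r
  note G = bounded_generator_domain_generator[OF f kernels]
  obtain B where B: "\<And>x. cmod (f x) \<le> B" using G(5) by blast
  obtain C where C: "\<And>x. cmod (generator P f x) \<le> C" using G(3) by blast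
  have C0: "0 \<le> C" using norm_ge_zero C order_trans by blast
  obtain D where D: "\<And>t x. t > 0 \<Longrightarrow> cmod (diff_quotient P f t x) \<le> D / t" using G(7) by blast
  have mb: "borel_measurable (\<mu> r) = borel_measurable borel" if "0 \<le> r" for r
    using \<mu>(2)[OF that] by (simp cong: measurable_cong_sets)
  have bound: "cmod (integral\<^sup>L (\<mu> r) h) \<le> c"
    if "0 \<le> r" "h \<in> borel_measurable borel" "\<And>x. cmod (h x) \<le> c" for r c and h :: "_ \<Rightarrow> complex"
  proof -
    interpret subprob_space "\<mu> r" using \<mu>(1)[OF that(1)] .
    have c: "0 \<le> c" using norm_ge_zero that(3) order_trans by blast
    have "cmod (integral\<^sup>L (\<mu> r) h) \<le> c * measure (\<mu> r) (space (\<mu> r))"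
      using that by (intro norm_integral_le_measure) (auto simp: mb)
    also have "\<dots> \<le> c" using c subprob_measure_le_1 by (intro mult_left_le) auto
    finally show ?thesis .
  qed
  have dq: "(u (r + h) - u r) / complex_of_real h = integral\<^sup>L (\<mu> r) (diff_quotient P f h)"
    if "0 \<le> r" "0 < h" for r h
  proof -
    interpret subprob_space "\<mu> r" using \<mu>(1)[OF that(1)] .
    have "u (r + h) = (\<integral>x. kernel_op (P h) f x \<partial>\<mu> r)"
      unfolding u_def kernel_op_def using that \<mu>
      by (simp add: \<mu>_add integral_bind_markov_kernel[OF _ _ K G(4) B])
    moreover have "integrable (\<mu> r) (kernel_op (P h) f)"
      unfolding kernel_op_def using that
      by (intro integrable_bounded[where B=B])
        (simp_all add: mb kernel_integral_measurable[OF K G(4)] kernel_integral_norm_le[OF K G(4) B])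
    moreover have "integrable (\<mu> r) f"
      using that G(4) B by (intro integrable_bounded) (simp_all add: mb)
    ultimately show ?thesis
      unfolding diff_quotient_def by (simp add: u_def)
  qed
  have "uniform_limit {0..} (\<lambda>h r. (u (r + h) - u r) / complex_of_real h) v (at_right 0)"
  proof (rule uniform_limitI)
    fix \<epsilon> :: real assume \<epsilon>: "\<epsilon> > 0"
    then have "\<forall>\<^sub>F h in at_right 0. \<forall>x\<in>UNIV. dist (diff_quotient P f h x) (generator P f x) < \<epsilon>/2"
      by (intro uniform_limitD[OF G(1)]) auto
    moreover have "\<forall>\<^sub>F h in at_right 0. h > (0::real)" by (rule eventually_at_right_less)
    ultimately show "\<forall>\<^sub>F h in at_right 0. \<forall>r\<in>{0..}. dist ((u (r + h) - u r) / complex_of_real h) (v r) < \<epsilon>"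
    proof eventually_elim
      fix h :: real
      assume h: "\<forall>x\<in>UNIV. dist (diff_quotient P f h x) (generator P f x) < \<epsilon>/2" "h > 0"
      show "\<forall>r\<in>{0..}. dist ((u (r + h) - u r) / complex_of_real h) (v r) < \<epsilon>"
      proof
        fix r :: real assume "r \<in> {0..}"
        then have r: "0 \<le> r" by simp
        interpret subprob_space "\<mu> r" using \<mu>(1)[OF r] .
        have "integrable (\<mu> r) (diff_quotient P f h)"
          using D[OF h(2)] G(6)[of h] h(2) r by (intro integrable_bounded) (simp_all add: mb)
        moreover have "integrable (\<mu> r) (generator P f)"
          using C G(2) r by (intro integrable_bounded) (simp_all add: mb)
        ultimately have "(u (r + h) - u r) / complex_of_real h - v r
            = (\<integral>x. diff_quotient P f h x - generator P f x \<partial>\<mu> r)"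
          using dq[OF r h(2)] by (simp add: v_def)
        also have "cmod \<dots> \<le> \<epsilon>/2"
          using h G(2,6) r by (intro bound) (auto simp: dist_norm less_imp_le)
        finally show "dist ((u (r + h) - u r) / complex_of_real h) (v r) < \<epsilon>"
          using \<epsilon> by (simp add: dist_norm)
      qed
    qed
  qed
  note U = uniform_forward_difference_quotient_integral[OF this]
  have "cmod (v r) \<le> C" if "0 \<le> r" for r
    unfolding v_def using that G(2) C by (rule bound)
  note U = U[OF this]
  show "continuous_on {0..} (\<lambda>r. integral\<^sup>L (\<mu> r) (generator P f))"
    and "0 \<le> t \<Longrightarrow> ((\<lambda>r. integral\<^sup>L (\<mu> r) (generator P f)) has_integral
      (integral\<^sup>L (\<mu> t) f - integral\<^sup>L (\<mu> 0) f)) {0..t}"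
    using U unfolding u_def v_def by auto
qed

section \<open>Path integrals, martingales and the Markov property tested on events of the canonical
  filtration\<close>

locale cadlag_process_setting = prob_space M
  for M :: "'w measure" +
  fixes X :: "real \<Rightarrow> 'w \<Rightarrow> 'x::{second_countable_topology, t2_space}"
  assumes lc: "locally_compact_space (euclidean :: 'x topology)"
    and cadlag: "cadlag_process M X"
begin

abbreviation \<F> :: "real \<Rightarrow> 'w measure" where "\<F> \<equiv> canonical_filtration M X"

lemma subalgebra_\<F>: "subalgebra M (\<F> t)"
  using cadlag by (rule subalgebra_canonical_filtration)

lemma sets_\<F>: "A \<in> sets (\<F> t) \<Longrightarrow> A \<in> sets M"
  using subalgebra_\<F>[of t] by (auto simp: subalgebra_def)

lemma space_\<F>[simp]: "space (\<F> t) = space M"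
  using subalgebra_\<F>[of t] by (auto simp: subalgebra_def)

lemma measurable_X[measurable]: "0 \<le> t \<Longrightarrow> X t \<in> borel_measurable M"
  using cadlag by (simp add: cadlag_process_def)

lemma clamped_measurable:
  assumes "0 \<le> t"
  shows "(\<lambda>(s, \<omega>). X (max 0 (min t s)) \<omega>) \<in> borel_measurable (borel \<Otimes>\<^sub>M \<F> t)"
    and "(\<lambda>(s, \<omega>). X (max 0 (min t s)) \<omega>) \<in> borel_measurable (borel \<Otimes>\<^sub>M M)"
proof -
  have rc: "((\<lambda>r. X r \<omega>) \<longlongrightarrow> X s \<omega>) (at_right s)" if "\<omega> \<in> space M" "0 \<le> s" for s \<omega>
    using cadlag that by (simp add: cadlag_process_def)
  show "(\<lambda>(s, \<omega>). X (max 0 (min t s)) \<omega>) \<in> borel_measurable (borel \<Otimes>\<^sub>M \<F> t)"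
    by (rule right_continuous_progressively_measurable[OF lc assms measurable_canonical_filtration rc]) simp_all
  show "(\<lambda>(s, \<omega>). X (max 0 (min t s)) \<omega>) \<in> borel_measurable (borel \<Otimes>\<^sub>M M)"
    by (rule right_continuous_progressively_measurable[OF lc assms measurable_X rc])
qed

text \<open>Lebesgue measure on \<open>[0, t]\<close> is kept as a finite measure \<open>L\<close>
  on the whole line, and \<open>H\<close>, built from the clamped path, is jointly measurable there
  and agrees with \<open>h (X s \<omega>)\<close> on \<open>[0, t]\<close>. Measurability over the
  filtration gives the first claim, Fubini with \<open>M\<close> restricted to \<open>A\<close> the
  last two.\<close>

lemma path_integral:
  fixes h :: "'x \<Rightarrow> complex"
  assumes t: "0 \<le> t" and h[measurable]: "h \<in> borel_measurable borel" and B: "\<And>x. cmod (h x) \<le> B"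
  shows "(\<lambda>\<omega>. LBINT s:{0..t}. h (X s \<omega>)) \<in> borel_measurable (\<F> t)"
    and "integrable M (\<lambda>\<omega>. LBINT s:{0..t}. h (X s \<omega>))"
    and "A \<in> sets M \<Longrightarrow> (LINT \<omega>:A|M. (LBINT s:{0..t}. h (X s \<omega>))) = (LBINT s:{0..t}. (LINT \<omega>:A|M. h (X s \<omega>)))"
    and "A \<in> sets M \<Longrightarrow> set_integrable lborel {0..t} (\<lambda>s. LINT \<omega>:A|M. h (X s \<omega>))"
proof -
  define H where "H s \<omega> = h (X (max 0 (min t s)) \<omega>)" for s \<omega>
  define L where "L = restricted_measure lborel {0..t}"
  have [measurable_cong]: "sets L = sets borel" by (simp add: L_def)
  have Hm: "(\<lambda>(s, \<omega>). H s \<omega>) \<in> borel_measurable (borel \<Otimes>\<^sub>M \<F> t)"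
    using measurable_compose[OF clamped_measurable(1)[OF t] h] by (simp add: H_def case_prod_beta')
  have HM[measurable]: "(\<lambda>(s, \<omega>). H s \<omega>) \<in> borel_measurable (borel \<Otimes>\<^sub>M M)"
    using measurable_compose[OF clamped_measurable(2)[OF t] h] by (simp add: H_def case_prod_beta')
  interpret L: finite_measure L
    unfolding L_def using t by (intro finite_measure_restricted_measure) auto
  have inner: "(LBINT s:{0..t}. h (X s \<omega>)) = (\<integral>s. H s \<omega> \<partial>L)" if "\<omega> \<in> space M" for \<omega>
  proof -
    have "(\<lambda>s. H s \<omega>) \<in> borel_measurable lborel" using that by measurable
    then have "(\<integral>s. H s \<omega> \<partial>L) = (LBINT s:{0..t}. H s \<omega>)"
      unfolding L_def by (intro integral_restricted_measure) auto
    also have "\<dots> = (LBINT s:{0..t}. h (X s \<omega>))"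
      by (intro set_lebesgue_integral_cong) (auto simp: H_def)
    finally show ?thesis by simp
  qed
  have "(\<lambda>\<omega>. \<integral>s. H s \<omega> \<partial>L) \<in> borel_measurable (\<F> t)"
    using measurable_pair_swap[OF Hm] by (intro L.borel_measurable_lebesgue_integral)
      (simp add: case_prod_beta' cong: measurable_cong_sets sets_pair_measure_cong add: L_def)
  then show meas: "(\<lambda>\<omega>. LBINT s:{0..t}. h (X s \<omega>)) \<in> borel_measurable (\<F> t)"
    using inner by (subst measurable_cong[where g="\<lambda>\<omega>. \<integral>s. H s \<omega> \<partial>L"]) auto
  have HB: "cmod (H s \<omega>) \<le> B" for s \<omega> using B by (simp add: H_def)
  have "integrable M (\<lambda>\<omega>. \<integral>s. H s \<omega> \<partial>L)"
  proof (rule integrable_bounded)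
    \<comment> \<open>The bound is demanded at every \<open>\<omega>\<close>, also outside
      \<open>space M\<close>, where the path need not be measurable. In the non-integrable case the
      integral has its default value 0, for which the visibly nonnegative \<open>max 0 B\<close>
      suffices.\<close>
    fix \<omega> show "cmod (\<integral>s. H s \<omega> \<partial>L) \<le> max 0 B * measure L (space L)"
    proof (cases "integrable L (\<lambda>s. H s \<omega>)")
      case True
      then show ?thesis
        using HB by (intro L.norm_integral_le_measure) (auto intro: max.coboundedI2)
    qed (simp add: not_integrable_integral_eq)
  qed measurable
  moreover have "integrable M (\<lambda>\<omega>. LBINT s:{0..t}. h (X s \<omega>)) \<longleftrightarrow> integrable M (\<lambda>\<omega>. \<integral>s. H s \<omega> \<partial>L)"
    by (intro Bochner_Integration.integrable_cong refl inner)
  ultimately show "integrable M (\<lambda>\<omega>. LBINT s:{0..t}. h (X s \<omega>))" by blast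
  assume A: "A \<in> sets M"
  define N where "N = restricted_measure M A"
  have [measurable_cong]: "sets N = sets M" by (simp add: N_def)
  interpret N: finite_measure N
    unfolding N_def using A by (intro finite_measure_restricted_measure) (auto simp: emeasure_eq_measure)
  interpret pair: pair_sigma_finite L N ..
  interpret prod: finite_measure "L \<Otimes>\<^sub>M N"
    by (rule finite_measure_pair_measure[OF N.finite_measure_axioms L.finite_measure_axioms])
  have ip: "integrable (L \<Otimes>\<^sub>M N) (\<lambda>(s, \<omega>). H s \<omega>)"
    using HB by (intro prod.integrable_bounded[where B=B]) (auto split: prod.splits)
  have outer: "(\<integral>\<omega>. H s \<omega> \<partial>N) = (LINT \<omega>:A|M. h (X s \<omega>))" if s: "s \<in> {0..t}" for s
  proof -
    have "(\<lambda>\<omega>. H s \<omega>) \<in> borel_measurable M" by measurable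
    then have "(\<integral>\<omega>. H s \<omega> \<partial>N) = (LINT \<omega>:A|M. H s \<omega>)"
      unfolding N_def using A by (intro integral_restricted_measure)
    then show ?thesis using s by (simp add: H_def)
  qed
  have im: "(\<lambda>s. \<integral>\<omega>. H s \<omega> \<partial>N) \<in> borel_measurable lborel" by measurable
  have "(LINT \<omega>:A|M. (LBINT s:{0..t}. h (X s \<omega>))) = (LINT \<omega>:A|M. (\<integral>s. H s \<omega> \<partial>L))"
    using inner sets.sets_into_space[OF A] by (intro set_lebesgue_integral_cong A) auto
  also have "\<dots> = (\<integral>\<omega>. (\<integral>s. H s \<omega> \<partial>L) \<partial>N)"
    unfolding N_def by (rule integral_restricted_measure[OF A, symmetric]) measurable
  also have "\<dots> = (\<integral>s. (\<integral>\<omega>. H s \<omega> \<partial>N) \<partial>L)" by (rule pair.Fubini_integral[OF ip])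
  also have "\<dots> = (LBINT s:{0..t}. (\<integral>\<omega>. H s \<omega> \<partial>N))"
    unfolding L_def using im by (intro integral_restricted_measure) auto
  also have "\<dots> = (LBINT s:{0..t}. (LINT \<omega>:A|M. h (X s \<omega>)))"
    using outer by (intro set_lebesgue_integral_cong) auto
  finally show "(LINT \<omega>:A|M. (LBINT s:{0..t}. h (X s \<omega>))) = (LBINT s:{0..t}. (LINT \<omega>:A|M. h (X s \<omega>)))" .
  have "integrable L (\<lambda>s. \<integral>\<omega>. H s \<omega> \<partial>N)" by (rule pair.integrable_fst[OF ip])
  then have "set_integrable lborel {0..t} (\<lambda>s. \<integral>\<omega>. H s \<omega> \<partial>N)"
    using im unfolding L_def by (subst (asm) integrable_restricted_measure) auto
  then show "set_integrable lborel {0..t} (\<lambda>s. LINT \<omega>:A|M. h (X s \<omega>))"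
    using outer by (subst set_integrable_cong[OF refl refl]) auto
qed

lemma integrable_process:
  fixes f :: "'x \<Rightarrow> complex"
  assumes "0 \<le> t" "f \<in> borel_measurable borel" "\<And>x. cmod (f x) \<le> B"
  shows "integrable M (\<lambda>\<omega>. f (X t \<omega>))"
  using assms by (intro integrable_bounded[where B=B]) (auto intro: measurable_compose[OF measurable_X])

lemma set_integrable_of_integrable:
  fixes f :: "'w \<Rightarrow> complex"
  assumes "A \<in> sets M" "integrable M f"
  shows "set_integrable M A f"
  using assms unfolding set_integrable_def by (rule integrable_mult_indicator)

text \<open>The initial term is constant in time and cancels between \<open>s\<close> and
  \<open>t\<close>, so giving it its own function \<open>k\<close> lets one statement cover
  \<open>Pi_process\<close>, with \<open>k = f\<close>, and the process of (3), with
  \<open>k = 0\<close>. What remains after Fubini is an equation between the numbers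
  \<open>E[f(X_t); A]\<close>.\<close>

lemma martingale_path_integral_iff:
  fixes f h k :: "'x \<Rightarrow> complex"
  assumes f: "f \<in> borel_measurable borel" "\<And>x. cmod (f x) \<le> Bf"
    and h: "h \<in> borel_measurable borel" "\<And>x. cmod (h x) \<le> Bh"
    and k: "k \<in> borel_measurable borel" "\<And>x. cmod (k x) \<le> Bk"
  shows "martingale M \<F> (\<lambda>t \<omega>. f (X t \<omega>) - k (X 0 \<omega>) - (LBINT s:{0..t}. h (X s \<omega>))) \<longleftrightarrow>
    (\<forall>s\<ge>0. \<forall>t\<ge>s. \<forall>A\<in>sets (\<F> s).
      (LINT \<omega>:A|M. f (X t \<omega>)) - (LINT \<omega>:A|M. f (X s \<omega>)) = (LBINT r:{s..t}. (LINT \<omega>:A|M. h (X r \<omega>))))"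
proof -
  define Y where "Y t \<omega> = f (X t \<omega>) - k (X 0 \<omega>) - (LBINT s:{0..t}. h (X s \<omega>))" for t \<omega>
  have fI: "integrable M (\<lambda>\<omega>. f (X t \<omega>))" if "0 \<le> t" for t by (rule integrable_process[OF that f])
  have kI: "integrable M (\<lambda>\<omega>. k (X 0 \<omega>))" by (rule integrable_process[OF _ k]) simp
  have "martingale M \<F> Y \<longleftrightarrow>
      (\<forall>s\<ge>0. \<forall>t\<ge>s. \<forall>A\<in>sets (\<F> s). (LINT \<omega>:A|M. Y t \<omega>) = (LINT \<omega>:A|M. Y s \<omega>))"
  proof (rule martingale_iff_set_integrals[OF prob_space_axioms subalgebra_\<F>])
    fix t :: real assume t: "0 \<le> t"
    show "Y t \<in> borel_measurable (\<F> t)"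
      unfolding Y_def using t
      by (intro borel_measurable_diff path_integral(1)[OF t h]
          measurable_compose[OF measurable_canonical_filtration f(1)]
          measurable_compose[OF measurable_canonical_filtration k(1)]) auto
    show "integrable M (Y t)"
      unfolding Y_def
      by (intro Bochner_Integration.integrable_diff path_integral(2)[OF t h] fI[OF t] kI)
  qed
  also have "\<dots> \<longleftrightarrow> (\<forall>s\<ge>0. \<forall>t\<ge>s. \<forall>A\<in>sets (\<F> s).
      (LINT \<omega>:A|M. f (X t \<omega>)) - (LINT \<omega>:A|M. f (X s \<omega>)) = (LBINT r:{s..t}. (LINT \<omega>:A|M. h (X r \<omega>))))"
  proof (intro all_cong1 imp_cong refl ball_cong)
    fix s t A assume s: "0 \<le> s" and st: "s \<le> t" and AF: "A \<in> sets (\<F> s)"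
    then have t: "0 \<le> t" and A: "A \<in> sets M" using sets_\<F> by auto
    note SI = set_integrable_of_integrable[OF A]
    have LY: "(LINT \<omega>:A|M. Y r \<omega>) = (LINT \<omega>:A|M. f (X r \<omega>)) - (LINT \<omega>:A|M. k (X 0 \<omega>))
        - (LBINT q:{0..r}. (LINT \<omega>:A|M. h (X q \<omega>)))" if r: "0 \<le> r" for r
      unfolding Y_def path_integral(3)[OF r h A, symmetric]
      using SI[OF fI[OF r]] SI[OF kI] SI[OF path_integral(2)[OF r h]]
      by (simp add: set_integral_diff)
    define b where "b q = (LINT \<omega>:A|M. h (X q \<omega>))" for q
    have bi: "set_integrable lborel {0..t} b" unfolding b_def by (rule path_integral(4)[OF t h A])
    have "set_integrable lborel {0..s} b" "set_integrable lborel {s..t} b"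
      using s st by (auto intro!: set_integrable_subset[OF bi])
    then have "(LBINT q:{0..t}. b q) = (LBINT q:{0..s}. b q) + (LBINT q:{s..t}. b q)"
      using bi s st
      by (simp add: set_borel_integral_eq_integral Henstock_Kurzweil_Integration.integral_combine)
    then show "((LINT \<omega>:A|M. Y t \<omega>) = (LINT \<omega>:A|M. Y s \<omega>)) \<longleftrightarrow>
      (LINT \<omega>:A|M. f (X t \<omega>)) - (LINT \<omega>:A|M. f (X s \<omega>)) = (LBINT r:{s..t}. (LINT \<omega>:A|M. h (X r \<omega>)))"
      unfolding LY[OF s] LY[OF t] b_def[symmetric] by (auto simp: algebra_simps)
  qed
  finally show ?thesis unfolding Y_def .
qed

lemma subprob_space_law_X:
  assumes "0 \<le> t" "A \<in> sets M"
  shows "subprob_space (restricted_law M A (X t))"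
  using assms by (intro subprob_space_restricted_law prob_space_axioms measurable_X)

text \<open>For fixed \<open>B\<close> the integral criterion for conditional expectations compares,
  event by event, the masses that two measures give to \<open>B\<close>. The exceptional null set
  may depend on \<open>B\<close>, but the integrals do not see it, so all \<open>B\<close> combine
  into one equality of measures. Finiteness permits passing between \<open>measure\<close> and
  \<open>emeasure\<close>.\<close>

lemma markov_process_iff_restricted_law:
  assumes kernels: "\<forall>t\<ge>0. markov_kernel (P t)"
  shows "markov_process M X P \<longleftrightarrow> (\<forall>s\<ge>0. \<forall>t\<ge>s. \<forall>A\<in>sets (\<F> s).
    restricted_law M A (X t) = restricted_law M A (X s) \<bind> P (t - s))"
proof -
  have "(\<forall>B\<in>sets borel. AE \<omega> in M. real_cond_exp M (\<F> s) (\<lambda>\<omega>. indicator B (X t \<omega>)) \<omega> =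
          measure (P (t - s) (X s \<omega>)) B) \<longleftrightarrow>
      (\<forall>A\<in>sets (\<F> s). restricted_law M A (X t) = restricted_law M A (X s) \<bind> P (t - s))"
    if s: "0 \<le> s" and st: "s \<le> t" for s t
  proof -
    interpret S: finite_measure_subalgebra M "\<F> s"
      using subalgebra_\<F> by unfold_locales
    have t: "0 \<le> t" using s st by simp
    have Kts: "markov_kernel (P (t - s))" using st kernels by simp
    have Km: "(\<lambda>x. measure (P (t - s) x) B) \<in> borel_measurable borel" if "B \<in> sets borel" for B
      using Kts that unfolding markov_kernel_def by measurable
    have K1: "measure (P (t - s) x) B \<le> 1" for x B
      using markov_kernelD(1)[OF Kts] by (rule prob_space.prob_le_1)
    have ae: "(AE \<omega> in M. real_cond_exp M (\<F> s) (\<lambda>\<omega>. indicator B (X t \<omega>)) \<omega> = measure (P (t - s) (X s \<omega>)) B)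
        \<longleftrightarrow> (\<forall>A\<in>sets (\<F> s). measure (restricted_law M A (X t)) B = measure (restricted_law M A (X s) \<bind> P (t - s)) B)"
      if B[measurable]: "B \<in> sets borel" for B
    proof -
      have "(AE \<omega> in M. real_cond_exp M (\<F> s) (\<lambda>\<omega>. indicator B (X t \<omega>)) \<omega> = measure (P (t - s) (X s \<omega>)) B)
        \<longleftrightarrow> (\<forall>A\<in>sets (\<F> s). (LINT \<omega>:A|M. indicator B (X t \<omega>)) = (LINT \<omega>:A|M. measure (P (t - s) (X s \<omega>)) B))"
      proof (rule S.real_cond_exp_AE_eq_iff)
        show "integrable M (\<lambda>\<omega>. indicator B (X t \<omega>) :: real)"
          using t by (intro integrable_const_bound[where B=1]) auto
        show "integrable M (\<lambda>\<omega>. measure (P (t - s) (X s \<omega>)) B)"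
          using s K1 by (intro integrable_const_bound[where B=1]) (auto intro: measurable_compose[OF measurable_X Km[OF B]])
        show "(\<lambda>\<omega>. measure (P (t - s) (X s \<omega>)) B) \<in> borel_measurable (\<F> s)"
          using s by (intro measurable_compose[OF measurable_canonical_filtration Km[OF B]]) auto
      qed
      also have "\<dots> \<longleftrightarrow> (\<forall>A\<in>sets (\<F> s). measure (restricted_law M A (X t)) B = measure (restricted_law M A (X s) \<bind> P (t - s)) B)"
      proof (intro ball_cong refl arg_cong2[where f="(=)"])
        fix A assume "A \<in> sets (\<F> s)"
        then have A: "A \<in> sets M" by (rule sets_\<F>)
        interpret Q: subprob_space "restricted_law M A (X s)" using subprob_space_law_X[OF s A] .
        have sb: "sets (restricted_law M A (X s) \<bind> P (t - s)) = sets borel"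
          using Kts by (intro sets_bind_markov_kernel) auto
        have "measure (restricted_law M A (X t)) B = (\<integral>x. indicator B x \<partial>restricted_law M A (X t))" by simp
        also have "\<dots> = (LINT \<omega>:A|M. indicator B (X t \<omega>))"
          using t by (intro integral_restricted_law A) auto
        finally show "(LINT \<omega>:A|M. indicator B (X t \<omega>)) = measure (restricted_law M A (X t)) B" by simp
        have "measure (restricted_law M A (X s) \<bind> P (t - s)) B = (\<integral>x. indicator B x \<partial>(restricted_law M A (X s) \<bind> P (t - s)))"
          using sets_eq_imp_space_eq[OF sb] by simp
        also have "\<dots> = (\<integral>x. (\<integral>y. indicator B y \<partial>P (t - s) x) \<partial>restricted_law M A (X s))"
          using Kts by (intro integral_bind_markov_kernel_real[where B=1] Q.finite_measure_axioms) auto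
        also have "\<dots> = (\<integral>x. measure (P (t - s) x) B \<partial>restricted_law M A (X s))"
          using markov_kernelD[OF Kts] by simp
        also have "\<dots> = (LINT \<omega>:A|M. measure (P (t - s) (X s \<omega>)) B)"
          using s by (intro integral_restricted_law A Km B) auto
        finally show "(LINT \<omega>:A|M. measure (P (t - s) (X s \<omega>)) B) = measure (restricted_law M A (X s) \<bind> P (t - s)) B" by simp
      qed
      finally show ?thesis .
    qed
    have "(restricted_law M A (X t) = restricted_law M A (X s) \<bind> P (t - s)) \<longleftrightarrow>
      (\<forall>B\<in>sets borel. measure (restricted_law M A (X t)) B = measure (restricted_law M A (X s) \<bind> P (t - s)) B)"
      if "A \<in> sets (\<F> s)" for A
    proof
      have A: "A \<in> sets M" using that by (rule sets_\<F>)
      interpret T: subprob_space "restricted_law M A (X t)" using subprob_space_law_X[OF t A] .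
      interpret Q: subprob_space "restricted_law M A (X s) \<bind> P (t - s)"
        using Kts by (intro subprob_bind_markov_kernel subprob_space_law_X[OF s A]) auto
      have sb: "sets (restricted_law M A (X s) \<bind> P (t - s)) = sets borel"
        using Kts by (intro sets_bind_markov_kernel) auto
      assume "\<forall>B\<in>sets borel. measure (restricted_law M A (X t)) B = measure (restricted_law M A (X s) \<bind> P (t - s)) B"
      then show "restricted_law M A (X t) = restricted_law M A (X s) \<bind> P (t - s)"
        by (intro measure_eqI) (simp_all add: sb T.emeasure_eq_measure Q.emeasure_eq_measure)
    qed simp
    then show ?thesis using ae by blast
  qed
  then show ?thesis unfolding markov_process_def by blast
qed

end

section \<open>Processes related to an integral transform\<close>

locale related_process = cadlag_process_setting M X
  for M :: "'w measure" and X :: "real \<Rightarrow> 'w \<Rightarrow> 'x::{second_countable_topology, t2_space}" +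
  fixes \<phi> :: "'l::t2_space \<Rightarrow> 'x \<Rightarrow> complex"
    and e :: 'x
    and P :: "real \<Rightarrow> 'x \<Rightarrow> 'x measure"
  assumes transform: "abstract_integral_transform \<phi>"
    and \<phi>_e: "\<And>\<xi>. \<phi> \<xi> e = 1"
    and semigroup: "related_semigroup \<phi> e P"
begin

section \<open>Exponential form of the transforms of the semigroup, and the equivalences\<close>

lemma kernel: "0 \<le> t \<Longrightarrow> markov_kernel (P t)"
  using semigroup by (simp add: related_semigroup_def)

lemma kernels: "\<forall>t\<ge>0. markov_kernel (P t)"
  using kernel by blast

lemma \<phi>_Cb: "\<phi> \<xi> \<in> Cb" and \<phi>_le_1: "cmod (\<phi> \<xi> x) \<le> 1"
  using transform by (auto simp: abstract_integral_transform_def)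

lemma \<phi>_continuous: "continuous_on UNIV (\<phi> \<xi>)"
  using \<phi>_Cb[of \<xi>] by (simp add: Cb_def)

lemma \<phi>_measurable: "\<phi> \<xi> \<in> borel_measurable borel"
  using \<phi>_continuous by (rule borel_measurable_continuous_onI)

lemma integral_\<phi>_kernel:
  assumes "0 \<le> t"
  shows "(\<integral>y. \<phi> \<xi> y \<partial>P t x) = transform \<phi> (P t e) \<xi> * \<phi> \<xi> x"
proof -
  have "related_kernel \<phi> e (P t)" using semigroup assms by (simp add: related_semigroup_def)
  then show ?thesis unfolding related_kernel_def transform_def by blast
qed

text \<open>Relatedness makes \<open>\<phi> \<xi>\<close> an eigenfunction of \<open>P t\<close>
  with eigenvalue \<open>transform \<phi> (P t e) \<xi>\<close>, so composition of kernels becomes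
  multiplication of eigenvalues and the scalar result applies. The exponential form also shows that
  the eigenvalues never vanish, which gives meaning to the division in (2).\<close>

lemma neg_def_function_limit:
    "((\<lambda>t. (1 - transform \<phi> (P t e) \<xi>) / complex_of_real t) \<longlongrightarrow> neg_def_function \<phi> e P \<xi>) (at_right 0)"
  and transform_eq_exp:
    "0 \<le> t \<Longrightarrow> transform \<phi> (P t e) \<xi> = exp (- (complex_of_real t * neg_def_function \<phi> e P \<xi>))"
proof -
  define g where "g t = transform \<phi> (P t e) \<xi>" for t
  have "continuous_on {0..} g"
    using semigroup \<phi>_Cb by (simp add: related_semigroup_def g_def transform_def)
  moreover have "g 0 = 1"
    using semigroup \<phi>_e \<phi>_measurable by (simp add: related_semigroup_def g_def transform_def integral_return)
  moreover have "g (s + t) = g s * g t" if s: "0 \<le> s" and t: "0 \<le> t" for s t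
  proof -
    have "g (s + t) = integral\<^sup>L (P s e \<bind> P t) (\<phi> \<xi>)"
      using semigroup s t by (simp add: related_semigroup_def g_def transform_def)
    also have "\<dots> = (\<integral>x. (\<integral>y. \<phi> \<xi> y \<partial>P t x) \<partial>P s e)"
      using markov_kernelD[OF kernel[OF s]]
      by (intro integral_bind_markov_kernel[OF _ _ kernel[OF t] \<phi>_measurable \<phi>_le_1] prob_space_imp_subprob_space)
    also have "\<dots> = g t * g s"
      by (simp add: integral_\<phi>_kernel[OF t]) (simp add: g_def transform_def)
    finally show ?thesis by simp
  qed
  moreover have "cmod (g t) \<le> 1" if "0 \<le> t" for t
    unfolding g_def transform_def by (rule kernel_integral_norm_le[OF kernel[OF that] \<phi>_measurable \<phi>_le_1])
  ultimately obtain \<psi> where \<psi>: "((\<lambda>h. (1 - g h) / complex_of_real h) \<longlongrightarrow> \<psi>) (at_right 0)"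
    "\<And>t. 0 \<le> t \<Longrightarrow> g t = exp (- (complex_of_real t * \<psi>))"
    by (rule continuous_multiplicative_imp_exp) blast+
  have "neg_def_function \<phi> e P \<xi> = \<psi>"
    using \<psi>(1) unfolding neg_def_function_def g_def by (intro tendsto_Lim trivial_limit_at_right_real)
  then show "((\<lambda>t. (1 - transform \<phi> (P t e) \<xi>) / complex_of_real t) \<longlongrightarrow> neg_def_function \<phi> e P \<xi>) (at_right 0)"
    and "0 \<le> t \<Longrightarrow> transform \<phi> (P t e) \<xi> = exp (- (complex_of_real t * neg_def_function \<phi> e P \<xi>))"
    using \<psi> by (simp_all add: g_def)
qed

text \<open>The difference quotient of \<open>\<phi> \<xi>\<close> is minus the scalar quotient
  \<open>(1 - transform \<phi> (P t e) \<xi>) / t\<close> times \<open>\<phi> \<xi>\<close>, and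
  \<open>cmod (\<phi> \<xi> x) \<le> 1\<close> makes its convergence uniform in
  \<open>x\<close>.\<close>

lemma \<phi>_bounded_generator_domain: "\<phi> \<xi> \<in> bounded_generator_domain P"
  and generator_\<phi>: "generator P (\<phi> \<xi>) = (\<lambda>x. - neg_def_function \<phi> e P \<xi> * \<phi> \<xi> x)"
proof -
  define \<psi> where "\<psi> = neg_def_function \<phi> e P \<xi>"
  have ul: "uniform_limit UNIV (diff_quotient P (\<phi> \<xi>)) (\<lambda>x. - \<psi> * \<phi> \<xi> x) (at_right 0)"
  proof (rule uniform_limitI)
    fix \<epsilon> :: real assume "\<epsilon> > 0"
    then have "\<forall>\<^sub>F t in at_right 0. dist ((1 - transform \<phi> (P t e) \<xi>) / complex_of_real t) \<psi> < \<epsilon>"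
      unfolding \<psi>_def by (rule tendstoD[OF neg_def_function_limit])
    moreover have "\<forall>\<^sub>F t in at_right 0. t > (0::real)" by (rule eventually_at_right_less)
    ultimately show "\<forall>\<^sub>F t in at_right 0. \<forall>x\<in>UNIV. dist (diff_quotient P (\<phi> \<xi>) t x) (- \<psi> * \<phi> \<xi> x) < \<epsilon>"
    proof eventually_elim
      fix t :: real
      assume t: "dist ((1 - transform \<phi> (P t e) \<xi>) / complex_of_real t) \<psi> < \<epsilon>" "t > 0"
      show "\<forall>x\<in>UNIV. dist (diff_quotient P (\<phi> \<xi>) t x) (- \<psi> * \<phi> \<xi> x) < \<epsilon>"
      proof
        fix x
        have "diff_quotient P (\<phi> \<xi>) t x - (- \<psi> * \<phi> \<xi> x)
            = - ((1 - transform \<phi> (P t e) \<xi>) / complex_of_real t - \<psi>) * \<phi> \<xi> x"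
          using t(2) by (simp add: diff_quotient_def kernel_op_def integral_\<phi>_kernel field_simps)
        then have "dist (diff_quotient P (\<phi> \<xi>) t x) (- \<psi> * \<phi> \<xi> x)
            = dist ((1 - transform \<phi> (P t e) \<xi>) / complex_of_real t) \<psi> * cmod (\<phi> \<xi> x)"
          by (simp only: dist_norm norm_mult norm_minus_cancel)
        also have "\<dots> \<le> dist ((1 - transform \<phi> (P t e) \<xi>) / complex_of_real t) \<psi>"
          by (intro mult_left_le \<phi>_le_1) simp
        finally show "dist (diff_quotient P (\<phi> \<xi>) t x) (- \<psi> * \<phi> \<xi> x) < \<epsilon>" using t(1) by simp
      qed
    qed
  qed
  have "\<forall>\<^sub>F t in at_right 0. \<forall>x. integrable (P t x) (\<phi> \<xi>)"
  proof (rule eventually_at_rightI[of 0 1])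
    fix t :: real assume "t \<in> {0<..<1}"
    then have K: "markov_kernel (P t)" by (intro kernel) auto
    show "\<forall>x. integrable (P t x) (\<phi> \<xi>)"
    proof
      fix x
      interpret Q: prob_space "P t x" using K by (rule markov_kernelD)
      show "integrable (P t x) (\<phi> \<xi>)"
        using \<phi>_measurable \<phi>_le_1 markov_kernelD(2)[OF K]
        by (intro Q.integrable_bounded[where B=1]) (simp_all cong: measurable_cong_sets)
    qed
  qed simp
  then show "\<phi> \<xi> \<in> bounded_generator_domain P"
    using ul \<phi>_Cb \<phi>_continuous by (auto simp: bounded_generator_domain_def generator_domain_def)
  show "generator P (\<phi> \<xi>) = (\<lambda>x. - neg_def_function \<phi> e P \<xi> * \<phi> \<xi> x)"
    unfolding generator_def \<psi>_def[symmetric]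
    using tendsto_uniform_limitI[OF ul] by (intro ext tendsto_Lim trivial_limit_at_right_real) simp
qed

text \<open>Both measures compared have mass at most 1, so injectivity of the transform applies. The
  quantifier over \<open>\<xi>\<close> is moved outermost because the martingale conditions are
  matched with this one separately for each \<open>\<xi>\<close>.\<close>

lemma markov_process_iff_transforms:
  "markov_process M X P \<longleftrightarrow> (\<forall>\<xi>. \<forall>s\<ge>0. \<forall>t\<ge>s. \<forall>A\<in>sets (\<F> s).
    (LINT \<omega>:A|M. \<phi> \<xi> (X t \<omega>)) = transform \<phi> (P (t - s) e) \<xi> * (LINT \<omega>:A|M. \<phi> \<xi> (X s \<omega>)))"
proof -
  have main: "restricted_law M A (X t) = restricted_law M A (X s) \<bind> P (t - s) \<longleftrightarrow>
      (\<forall>\<xi>. (LINT \<omega>:A|M. \<phi> \<xi> (X t \<omega>)) = transform \<phi> (P (t - s) e) \<xi> * (LINT \<omega>:A|M. \<phi> \<xi> (X s \<omega>)))"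
    if s: "0 \<le> s" and st: "s \<le> t" and AF: "A \<in> sets (\<F> s)" for s t A
  proof -
    have t: "0 \<le> t" and ts: "0 \<le> t - s" using s st by linarith+
    have A: "A \<in> sets M" using AF by (rule sets_\<F>)
    define \<mu> where "\<mu> = restricted_law M A (X t)"
    define \<nu> where "\<nu> = restricted_law M A (X s) \<bind> P (t - s)"
    have \<nu>: "subprob_space \<nu>" "sets \<nu> = sets borel"
      unfolding \<nu>_def
      using subprob_bind_markov_kernel[OF subprob_space_law_X[OF s A] sets_restricted_law kernel[OF ts]]
        sets_bind_markov_kernel[OF sets_restricted_law kernel[OF ts]] by auto
    have \<mu>: "subprob_space \<mu>" "sets \<mu> = sets borel"
      using subprob_space_law_X[OF t A] by (simp_all add: \<mu>_def)
    have "transform \<phi> \<mu> \<xi> = (LINT \<omega>:A|M. \<phi> \<xi> (X t \<omega>))" for \<xi>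
      unfolding transform_def \<mu>_def by (intro integral_restricted_law A measurable_X t \<phi>_measurable)
    moreover have "transform \<phi> \<nu> \<xi> = transform \<phi> (P (t - s) e) \<xi> * (LINT \<omega>:A|M. \<phi> \<xi> (X s \<omega>))" for \<xi>
    proof -
      have "transform \<phi> \<nu> \<xi> = (\<integral>x. (\<integral>y. \<phi> \<xi> y \<partial>P (t - s) x) \<partial>restricted_law M A (X s))"
        unfolding \<nu>_def transform_def
        by (rule integral_bind_markov_kernel[OF subprob_space_law_X[OF s A] _ kernel[OF ts] \<phi>_measurable \<phi>_le_1]) simp
      also have "\<dots> = transform \<phi> (P (t - s) e) \<xi> * (\<integral>x. \<phi> \<xi> x \<partial>restricted_law M A (X s))"
        by (simp add: integral_\<phi>_kernel[OF ts])
      also have "(\<integral>x. \<phi> \<xi> x \<partial>restricted_law M A (X s)) = (LINT \<omega>:A|M. \<phi> \<xi> (X s \<omega>))"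
        by (intro integral_restricted_law A measurable_X s \<phi>_measurable)
      finally show ?thesis .
    qed
    moreover have "\<mu> = \<nu> \<longleftrightarrow> (\<forall>\<xi>. transform \<phi> \<mu> \<xi> = transform \<phi> \<nu> \<xi>)"
      using transform_injective[OF transform] \<mu> \<nu> by (auto simp: subprob_space_def)
    ultimately show ?thesis by (simp add: \<mu>_def \<nu>_def)
  qed
  have "markov_process M X P \<longleftrightarrow> (\<forall>s\<ge>0. \<forall>t\<ge>s. \<forall>A\<in>sets (\<F> s). \<forall>\<xi>.
      (LINT \<omega>:A|M. \<phi> \<xi> (X t \<omega>)) = transform \<phi> (P (t - s) e) \<xi> * (LINT \<omega>:A|M. \<phi> \<xi> (X s \<omega>)))"
    unfolding markov_process_iff_restricted_law[OF kernels]
    by (intro all_cong1 imp_cong ball_cong refl main)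
  then show ?thesis by blast
qed

lemma markov_process_iff_normalized_martingale:
  "markov_process M X P \<longleftrightarrow>
    (\<forall>\<xi>. martingale M \<F> (\<lambda>t \<omega>. 1 / transform \<phi> (P t e) \<xi> * \<phi> \<xi> (X t \<omega>)))"
proof -
  have "martingale M \<F> (\<lambda>t \<omega>. 1 / transform \<phi> (P t e) \<xi> * \<phi> \<xi> (X t \<omega>)) \<longleftrightarrow>
    (\<forall>s\<ge>0. \<forall>t\<ge>s. \<forall>A\<in>sets (\<F> s).
      (LINT \<omega>:A|M. \<phi> \<xi> (X t \<omega>)) = transform \<phi> (P (t - s) e) \<xi> * (LINT \<omega>:A|M. \<phi> \<xi> (X s \<omega>)))" for \<xi>
  proof -
    define g where "g t = transform \<phi> (P t e) \<xi>" for t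
    have "martingale M \<F> (\<lambda>t \<omega>. 1 / g t * \<phi> \<xi> (X t \<omega>)) \<longleftrightarrow>
      (\<forall>s\<ge>0. \<forall>t\<ge>s. \<forall>A\<in>sets (\<F> s). (LINT \<omega>:A|M. 1 / g t * \<phi> \<xi> (X t \<omega>)) = (LINT \<omega>:A|M. 1 / g s * \<phi> \<xi> (X s \<omega>)))"
    proof (rule martingale_iff_set_integrals[OF prob_space_axioms subalgebra_\<F>])
      fix t :: real assume t: "0 \<le> t"
      show "(\<lambda>\<omega>. 1 / g t * \<phi> \<xi> (X t \<omega>)) \<in> borel_measurable (\<F> t)"
        using t by (intro borel_measurable_times borel_measurable_const
            measurable_compose[OF measurable_canonical_filtration \<phi>_measurable]) auto
      show "integrable M (\<lambda>\<omega>. 1 / g t * \<phi> \<xi> (X t \<omega>))"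
        by (intro integrable_mult_right integrable_process[OF t \<phi>_measurable \<phi>_le_1])
    qed
    also have "\<dots> \<longleftrightarrow> (\<forall>s\<ge>0. \<forall>t\<ge>s. \<forall>A\<in>sets (\<F> s).
      (LINT \<omega>:A|M. \<phi> \<xi> (X t \<omega>)) = g (t - s) * (LINT \<omega>:A|M. \<phi> \<xi> (X s \<omega>)))"
    proof (intro all_cong1 imp_cong refl ball_cong)
      fix s t :: real and A assume st: "0 \<le> s" "s \<le> t"
      have g: "g s \<noteq> 0" "g t \<noteq> 0" using st by (simp_all add: g_def transform_eq_exp)
      \<comment> \<open>Dividing the identity for \<open>\<phi> \<xi>\<close> by
        \<open>g t = g (t - s) * g s\<close> absorbs the factor \<open>g (t - s)\<close> and leaves
        the normalisations \<open>1 / g t\<close> and \<open>1 / g s\<close> on the two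
        sides.\<close>
      have gts: "g t = g (t - s) * g s"
        using st by (simp add: g_def transform_eq_exp exp_add[symmetric] algebra_simps)
      have "(LINT \<omega>:A|M. 1 / g t * \<phi> \<xi> (X t \<omega>)) = (LINT \<omega>:A|M. \<phi> \<xi> (X t \<omega>)) / g t" for t
        by simp
      then show "((LINT \<omega>:A|M. 1 / g t * \<phi> \<xi> (X t \<omega>)) = (LINT \<omega>:A|M. 1 / g s * \<phi> \<xi> (X s \<omega>))) \<longleftrightarrow>
          ((LINT \<omega>:A|M. \<phi> \<xi> (X t \<omega>)) = g (t - s) * (LINT \<omega>:A|M. \<phi> \<xi> (X s \<omega>)))"
        using g gts by (simp add: field_simps)
    qed
    finally show ?thesis unfolding g_def .
  qed
  then show ?thesis unfolding markov_process_iff_transforms by blast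
qed

lemma Pi_martingale_iff:
  assumes f: "f \<in> bounded_generator_domain P"
  shows "martingale M \<F> (Pi_process (generator P) f X) \<longleftrightarrow>
    (\<forall>s\<ge>0. \<forall>t\<ge>s. \<forall>A\<in>sets (\<F> s). (LINT \<omega>:A|M. f (X t \<omega>)) - (LINT \<omega>:A|M. f (X s \<omega>)) =
      (LBINT r:{s..t}. (LINT \<omega>:A|M. generator P f (X r \<omega>))))"
proof -
  note G = bounded_generator_domain_generator[OF f kernels]
  obtain B where B: "\<And>x. cmod (f x) \<le> B" using G(5) by blast
  obtain C where C: "\<And>x. cmod (generator P f x) \<le> C" using G(3) by blast
  show ?thesis
    unfolding Pi_process_def[abs_def] by (rule martingale_path_integral_iff[OF G(4) B G(2) C G(4) B])
qed

text \<open>The two processes differ by \<open>\<phi> \<xi> (X 0 \<omega>)\<close>, which does not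
  depend on time, and \<open>generator P (\<phi> \<xi>)\<close> is a scalar multiple of
  \<open>\<phi> \<xi>\<close>; both martingale properties therefore reduce to the same equation over
  events.\<close>

lemma Pi_martingale_\<phi>_iff:
  "martingale M \<F> (Pi_process (generator P) (\<phi> \<xi>) X) \<longleftrightarrow>
   martingale M \<F> (\<lambda>t \<omega>. \<phi> \<xi> (X t \<omega>) + neg_def_function \<phi> e P \<xi> * (LBINT s:{0..t}. \<phi> \<xi> (X s \<omega>)))"
proof -
  define \<psi> where "\<psi> = neg_def_function \<phi> e P \<xi>"
  have "(\<lambda>t \<omega>. \<phi> \<xi> (X t \<omega>) + \<psi> * (LBINT s:{0..t}. \<phi> \<xi> (X s \<omega>)))
      = (\<lambda>t \<omega>. \<phi> \<xi> (X t \<omega>) - 0 - (LBINT s:{0..t}. - \<psi> * \<phi> \<xi> (X s \<omega>)))"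
    by (intro ext) (simp only: set_integral_mult_right, simp)
  moreover have "martingale M \<F> (\<lambda>t \<omega>. \<phi> \<xi> (X t \<omega>) - 0 - (LBINT s:{0..t}. - \<psi> * \<phi> \<xi> (X s \<omega>))) \<longleftrightarrow>
    (\<forall>s\<ge>0. \<forall>t\<ge>s. \<forall>A\<in>sets (\<F> s). (LINT \<omega>:A|M. \<phi> \<xi> (X t \<omega>)) - (LINT \<omega>:A|M. \<phi> \<xi> (X s \<omega>)) =
      (LBINT r:{s..t}. (LINT \<omega>:A|M. - \<psi> * \<phi> \<xi> (X r \<omega>))))"
  proof (rule martingale_path_integral_iff[where k="\<lambda>_. 0" and Bk=0])
    show "cmod (- \<psi> * \<phi> \<xi> x) \<le> cmod \<psi>" for x
      using \<phi>_le_1[of \<xi> x] by (simp add: norm_mult mult_left_le)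
  qed (use \<phi>_measurable \<phi>_le_1 in auto)
  ultimately show ?thesis
    unfolding Pi_martingale_iff[OF \<phi>_bounded_generator_domain] generator_\<phi> \<psi>_def by simp
qed

lemma markov_process_imp_Pi_martingale:
  assumes markov: "markov_process M X P" and f: "f \<in> bounded_generator_domain P"
  shows "martingale M \<F> (Pi_process (generator P) f X)"
  unfolding Pi_martingale_iff[OF f]
proof (intro allI impI ballI)
  fix s t A assume s: "0 \<le> s" and st: "s \<le> t" and AF: "A \<in> sets (\<F> s)"
  then have A: "A \<in> sets M" by (intro sets_\<F>)
  note G = bounded_generator_domain_generator[OF f kernels]
  define \<mu> where "\<mu> r = restricted_law M A (X (s + r))" for r
  have int\<mu>: "integral\<^sup>L (\<mu> r) h = (LINT \<omega>:A|M. h (X (s + r) \<omega>))"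
    if "0 \<le> r" "h \<in> borel_measurable borel" for r and h :: "'x \<Rightarrow> complex"
    unfolding \<mu>_def using that s by (intro integral_restricted_law A measurable_X) auto
  \<comment> \<open>An event of the filtration at time \<open>s\<close> also belongs to it at time
    \<open>s + r\<close>, so the Markov property at all later times may be used with the same
    \<open>A\<close>; this makes the restricted laws a flow, as Dynkin's formula requires.\<close>
  have add: "\<mu> (r + h) = \<mu> r \<bind> P h" if "0 \<le> r" "0 \<le> h" for r h
  proof -
    have "A \<in> sets (\<F> (s + r))" using AF sets_canonical_filtration_mono[of s "s + r"] that(1) by auto
    then have "restricted_law M A (X (s + r + h)) = restricted_law M A (X (s + r)) \<bind> P (s + r + h - (s + r))"
      using markov[unfolded markov_process_iff_restricted_law[OF kernels], rule_format, of "s + r" "s + r + h" A]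
        that s by simp
    then show ?thesis by (simp add: \<mu>_def add.assoc)
  qed
  have sp: "subprob_space (\<mu> r)" "sets (\<mu> r) = sets borel" if "0 \<le> r" for r
    using subprob_space_law_X[OF _ A, of "s + r"] s that by (simp_all add: \<mu>_def)
  define b where "b r = (LINT \<omega>:A|M. generator P f (X r \<omega>))" for r
  define v where "v r = integral\<^sup>L (\<mu> r) (generator P f)" for r
  have bv: "b r = v (r - s)" if "s \<le> r" for r
    using that int\<mu>[OF _ G(2), of "r - s"] by (simp add: b_def v_def)
  have D: "continuous_on {0..} v"
    unfolding v_def by (rule Dynkin_formula(1)[OF f kernels, of \<mu>]) (use sp add in auto)
  have "continuous_on {s..t} (\<lambda>r. v (r - s))"
    by (rule continuous_on_compose2[OF D]) (auto intro!: continuous_intros)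
  then have "continuous_on {s..t} b" by (rule continuous_on_eq) (simp add: bv)
  then have bi: "set_integrable lborel {s..t} b" by (rule borel_integrable_atLeastAtMost')
  have "(v has_integral (integral\<^sup>L (\<mu> (t - s)) f - integral\<^sup>L (\<mu> 0) f)) {0..t - s}"
    unfolding v_def by (rule Dynkin_formula(2)[OF f kernels, of \<mu>]) (use sp add st in auto)
  \<comment> \<open>The flow is timed from 0, the process from \<open>s\<close>; translation by
    \<open>s\<close> carries the integral from \<open>[0, t - s]\<close> to
    \<open>[s, t]\<close>.\<close>
  then have "((b \<circ> (+) s) has_integral (integral\<^sup>L (\<mu> (t - s)) f - integral\<^sup>L (\<mu> 0) f)) {0..t - s}"
    by (rule has_integral_eq[rotated]) (simp add: bv)
  then have "(b has_integral (integral\<^sup>L (\<mu> (t - s)) f - integral\<^sup>L (\<mu> 0) f)) {s..t}"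
    unfolding has_integral_shift_Icc_real by simp
  then have "(LBINT r:{s..t}. b r) = integral\<^sup>L (\<mu> (t - s)) f - integral\<^sup>L (\<mu> 0) f"
    using set_borel_integral_eq_integral(2)[OF bi] by (simp add: integral_unique)
  then show "(LINT \<omega>:A|M. f (X t \<omega>)) - (LINT \<omega>:A|M. f (X s \<omega>)) =
      (LBINT r:{s..t}. (LINT \<omega>:A|M. generator P f (X r \<omega>)))"
    using st int\<mu>[OF _ G(4), of "t - s"] int\<mu>[OF _ G(4), of 0] by (simp add: b_def)
qed

lemma Pi_martingale_\<phi>_imp_markov_process:
  assumes "\<And>\<xi>. martingale M \<F> (Pi_process (generator P) (\<phi> \<xi>) X)"
  shows "markov_process M X P"
  unfolding markov_process_iff_transforms
proof (intro allI impI ballI)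
  fix \<xi> s t A assume s: "0 \<le> s" and st: "s \<le> t" and AF: "A \<in> sets (\<F> s)"
  then have A: "A \<in> sets M" by (intro sets_\<F>)
  define \<psi> where "\<psi> = neg_def_function \<phi> e P \<xi>"
  define m where "m r = (LINT \<omega>:A|M. \<phi> \<xi> (X r \<omega>))" for r
  have "set_integrable lborel {0..t} m"
    unfolding m_def using s st by (intro path_integral(4)[OF _ \<phi>_measurable \<phi>_le_1 A]) simp
  then have "set_integrable lborel {s..t} m"
    by (rule set_integrable_subset) (use s in auto)
  \<comment> \<open>The martingale property between \<open>s\<close> and every later
    \<open>r\<close> is used with the same \<open>A\<close>, so the linear equation holds on the
    whole interval and not just at its right end.\<close>
  moreover have "m r = m s - \<psi> * (LBINT q:{s..r}. m q)" if "s \<le> r" for r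
  proof -
    have "m r - m s = (LBINT q:{s..r}. (LINT \<omega>:A|M. - \<psi> * \<phi> \<xi> (X q \<omega>)))"
      using assms[of \<xi>] s that AF
      unfolding Pi_martingale_iff[OF \<phi>_bounded_generator_domain] generator_\<phi> \<psi>_def[symmetric] m_def by blast
    also have "\<dots> = - \<psi> * (LBINT q:{s..r}. m q)"
      unfolding m_def by (simp only: set_integral_mult_right)
    finally show ?thesis by (simp add: algebra_simps)
  qed
  ultimately have "m t = exp (- (complex_of_real (t - s) * \<psi>)) * m s"
    by (intro linear_integral_equation_unique[OF st])
  then show "(LINT \<omega>:A|M. \<phi> \<xi> (X t \<omega>)) = transform \<phi> (P (t - s) e) \<xi> * (LINT \<omega>:A|M. \<phi> \<xi> (X s \<omega>))"
    using st by (simp add: m_def transform_eq_exp \<psi>_def)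
qed

end

theorem theorem4p27:
  fixes \<phi> :: "'l::t2_space \<Rightarrow> 'x::{second_countable_topology, t2_space} \<Rightarrow> complex"
    and e :: 'x
    and P :: "real \<Rightarrow> 'x \<Rightarrow> 'x measure"
    and M :: "'w measure"
    and X :: "real \<Rightarrow> 'w \<Rightarrow> 'x"
  assumes "abstract_integral_transform \<phi>"
    and "\<And>\<xi>. \<phi> \<xi> e = 1"
    and "related_semigroup \<phi> e P"
    and "prob_space M"
    and "cadlag_process M X"
  shows "(markov_process M X P \<longleftrightarrow>
            (\<forall>\<xi>. martingale M (canonical_filtration M X) (\<lambda>t \<omega>. 1 / transform \<phi> (P t e) \<xi> * \<phi> \<xi> (X t \<omega>)))) \<and>
         (markov_process M X P \<longleftrightarrow>
            (\<forall>\<xi>. martingale M (canonical_filtration M X)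
               (\<lambda>t \<omega>. \<phi> \<xi> (X t \<omega>) + neg_def_function \<phi> e P \<xi> * (LBINT s:{0..t}. \<phi> \<xi> (X s \<omega>))))) \<and>
         (markov_process M X P \<longleftrightarrow>
            (\<forall>\<xi>. martingale M (canonical_filtration M X) (Pi_process (generator P) (\<phi> \<xi>) X))) \<and>
         (markov_process M X P \<longleftrightarrow>
            (\<forall>f\<in>bounded_generator_domain P. martingale M (canonical_filtration M X) (Pi_process (generator P) f X)))"
proof -
  interpret prob_space M by fact
  interpret related_process M X \<phi> e P
  proof unfold_locales
    show "locally_compact_space (euclidean :: 'x topology)"
      using assms(1) by (simp add: abstract_integral_transform_def)
  qed (use assms in auto)
  have "markov_process M X P \<longleftrightarrow> (\<forall>\<xi>. martingale M \<F> (Pi_process (generator P) (\<phi> \<xi>) X))"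
    using markov_process_imp_Pi_martingale[OF _ \<phi>_bounded_generator_domain]
      Pi_martingale_\<phi>_imp_markov_process by blast
  moreover have "markov_process M X P \<longleftrightarrow>
      (\<forall>f\<in>bounded_generator_domain P. martingale M \<F> (Pi_process (generator P) f X))"
    using markov_process_imp_Pi_martingale \<phi>_bounded_generator_domain
      Pi_martingale_\<phi>_imp_markov_process by blast
  ultimately show ?thesis
    using markov_process_iff_normalized_martingale Pi_martingale_\<phi>_iff by simp
qed

end
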